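(* There is a function $g\in L^2(\mathbb{R})$ such that $(g,1,1)=(E_mT_ng)_{m,n\in\mathbb{Z}}$ is a Weyl-Heisenberg frame for $L^2(\mathbb{R})$ and such that for all $f\in L^2(\mathbb{R})$ the series on the right-hand side of the WH-frame Identity converges and is equal to the left-hand side, i.e. $$\sum_{m,n\in\mathbb{Z}}|\langle f,E_mT_ng\rangle|^2=\lim_{K,L\to\infty}\sum_{k=-L}^{K}\int_{\mathbb{R}}\overline{f(t)}f(t-k)G_k(t)\,dt\quad\text{for all } f\in L^2(\mathbb{R}).$$ However, there is a function $h\in L^2(\mathbb{R})$ so that the series on the right-hand side of the WH-frame Identity, $$\sum_{k\in\mathbb{Z}}\int_{\mathbb{R}}\overline{h(t)}h(t-k)G_k(t)\,dt,$$ does not converge unconditionally.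
   Context: For $c\in\mathbb{R}$ let $T_cf(x)=f(x-c)$ and $E_cf(x)=e^{2\pi i c x}f(x)$. The system $(g,1,1)=(E_mT_ng)_{m,n\in\mathbb{Z}}$ is a Weyl-Heisenberg frame (WH-frame) if there are constants $A,B>0$ with $A\|f\|^2\le\sum_{m,n\in\mathbb{Z}}|\langle f,E_mT_ng\rangle|^2\le B\|f\|^2$ for all $f\in L^2(\mathbb{R})$. Put $G_k(t)=\sum_{n\in\mathbb{Z}}g(t-n)\overline{g(t-n-k)}$ for $k\in\mathbb{Z}$. The WH-frame Identity for $f$ (with parameters $a=b=1$) is $\sum_{m,n\in\mathbb{Z}}|\langle f,E_mT_ng\rangle|^2=\sum_{k\in\mathbb{Z}}\int_{\mathbb{R}}\overline{f(t)}f(t-k)G_k(t)\,dt$. In $\lim_{K,L\to\infty}$ the indices $K$ and $L$ tend to infinity independently. *)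

theory Defs
  imports "HOL-Analysis.Analysis"
begin

text \<open>
  Elements of \<open>L\<^sup>2(\<real>)\<close> are represented by Lebesgue measurable functions; all notions below are
  invariant under changing a representative on a null set.
\<close>

definition L2 :: "(real \<Rightarrow> complex) set" where
  "L2 = {f. f \<in> borel_measurable lebesgue \<and> integrable lebesgue (\<lambda>x. (cmod (f x))\<^sup>2)}"

definition L2_inner :: "(real \<Rightarrow> complex) \<Rightarrow> (real \<Rightarrow> complex) \<Rightarrow> complex" where
  "L2_inner f g = (LINT x|lebesgue. f x * cnj (g x))"

definition L2_norm :: "(real \<Rightarrow> complex) \<Rightarrow> real" where
  "L2_norm f = sqrt (LINT x|lebesgue. (cmod (f x))\<^sup>2)"

definition translate :: "real \<Rightarrow> (real \<Rightarrow> complex) \<Rightarrow> real \<Rightarrow> complex" where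
  "translate c f x = f (x - c)"

definition modulate :: "real \<Rightarrow> (real \<Rightarrow> complex) \<Rightarrow> real \<Rightarrow> complex" where
  "modulate c f x = exp (2 * complex_of_real pi * \<i> * complex_of_real c * complex_of_real x) * f x"

definition WH_system :: "(real \<Rightarrow> complex) \<Rightarrow> int \<times> int \<Rightarrow> real \<Rightarrow> complex" where
  "WH_system g = (\<lambda>(m, n). modulate (of_int m) (translate (of_int n) g))"

text \<open>
  An infinite sum of reals that does not converge has the value \<open>0\<close>, so the finiteness implicit in
  the upper frame bound is stated as a separate summability condition.
\<close>

definition WH_frame :: "(real \<Rightarrow> complex) \<Rightarrow> bool" where
  "WH_frame g \<longleftrightarrow> (\<exists>A>0. \<exists>B>0. \<forall>f\<in>L2.
      (\<lambda>p. (cmod (L2_inner f (WH_system g p)))\<^sup>2) summable_on UNIV \<and>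
      A * (L2_norm f)\<^sup>2 \<le> (\<Sum>\<^sub>\<infinity>p\<in>UNIV. (cmod (L2_inner f (WH_system g p)))\<^sup>2) \<and>
      (\<Sum>\<^sub>\<infinity>p\<in>UNIV. (cmod (L2_inner f (WH_system g p)))\<^sup>2) \<le> B * (L2_norm f)\<^sup>2)"

text \<open>
  For \<open>g \<in> L\<^sup>2(\<real>)\<close> the series defining \<open>G\<^sub>k(t)\<close> converges absolutely for almost every \<open>t\<close>; the
  default value \<open>0\<close> is taken only on the exceptional null set.
\<close>

definition WH_G :: "(real \<Rightarrow> complex) \<Rightarrow> int \<Rightarrow> real \<Rightarrow> complex" where
  "WH_G g k t = (\<Sum>\<^sub>\<infinity>n::int. g (t - of_int n) * cnj (g (t - of_int n - of_int k)))"

text \<open>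
  If \<open>(g,1,1)\<close> is a WH-frame then every \<open>G\<^sub>k\<close> is essentially bounded, so the integrand is integrable
  for every \<open>f \<in> L\<^sup>2(\<real>)\<close>, and the default value of the integral plays no role.
\<close>

definition WH_identity_term :: "(real \<Rightarrow> complex) \<Rightarrow> (real \<Rightarrow> complex) \<Rightarrow> int \<Rightarrow> complex" where
  "WH_identity_term g f k = (LINT t|lebesgue. cnj (f t) * f (t - of_int k) * WH_G g k t)"

end

theory Submission
  imports Defs "HOL-Real_Asymp.Real_Asymp"
begin

text \<open>
  Split the real line into the fibers \<open>t + \<int>\<close> with \<open>0 \<le> t < 1\<close> and let the window \<open>g\<close> on the fiber over \<open>t\<close>
  be a finite sequence \<open>c\<^sub>t\<close>. Then \<open>G\<^sub>k(t)\<close> is the \<open>k\<close>-th autocorrelation coefficient of \<open>c\<^sub>t\<close>, that is, the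
  \<open>k\<close>-th Fourier coefficient of \<open>|p\<^sub>t|\<^sup>2\<close>, where \<open>p\<^sub>t\<close> is the trigonometric polynomial with coefficients \<open>c\<^sub>t\<close>
  (the Zak transform of \<open>g\<close>). Pairing these coefficients with the autocorrelation of a square
  summable sequence is a Toeplitz form, and such a form is bounded by the supremum norm of its symbol
  (\<open>toeplitz_form_bound\<close>). This reduces everything to the polynomials \<open>|p\<^sub>t|\<^sup>2\<close>:

  \<^item> by Parseval on the unit interval (\<open>parseval\<close>), the sum of the squared frame coefficients of \<open>f\<close> is the
    integral over \<open>t\<close> of the forms with symbols \<open>|p\<^sub>t|\<^sup>2\<close> (\<open>WH_coefficients_has_sum\<close>). So \<open>g\<close> generates a frame
    as soon as \<open>|p\<^sub>t|\<^sup>2\<close> is bounded above and bounded away from \<open>0\<close> uniformly in \<open>t\<close>;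
  \<^item> if the sums of \<open>G\<^sub>k(t) e\<^sup>2\<^sup>\<pi>\<^sup>i\<^sup>k\<^sup>\<nu>\<close> over all intervals of indices \<open>k\<close> are bounded uniformly in \<open>t\<close> and \<open>\<nu>\<close>, then
    the partial sums of the identity are dominated by an integrable function of \<open>t\<close>. They are
    eventually constant for each \<open>t\<close>, so the identity holds (\<open>identity_series_tendsto\<close>);
  \<^item> if the sums of \<open>|G\<^sub>k(t)|\<close> grow quickly enough as \<open>t\<close> tends to \<open>0\<close>, then the identity for a suitable \<open>h\<close>
    is not absolutely convergent, and for complex series this means not unconditionally convergent
    (\<open>identity_series_box_not_summable\<close>).

  Rudin-Shapiro polynomials make all three possible: with \<open>N\<close> coefficients \<open>\<plusminus>1\<close> they and their partial sums
  are of size \<open>\<surd>N\<close>. For \<open>t\<close> in the \<open>i\<close>-th of countably many intervals, \<open>p\<^sub>t\<close> is the constant \<open>3\<close> plus \<open>8\<^sup>-\<^sup>i\<close>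
  times such a polynomial with \<open>N = 16\<^sup>i\<close>, its frequencies shifted and dilated. The perturbation has size
  at most \<open>\<surd>2\<close>, its contribution to the partial sums of \<open>|p\<^sub>t|\<^sup>2\<close> is bounded, but its coefficients sum to
  \<open>2\<^sup>i\<close> in absolute value. The dilations separate the frequencies of different intervals, so that no
  cancellation occurs between them.
\<close>

section \<open>Rudin-Shapiro polynomials\<close>

fun rs_sign :: "bool \<Rightarrow> nat \<Rightarrow> nat \<Rightarrow> real" where
  "rs_sign b 0 n = 1"
| "rs_sign b (Suc r) n =
    (if n < 2 ^ r then rs_sign True r n else (if b then 1 else - 1) * rs_sign False r (n - 2 ^ r))"

lemma abs_rs_sign [simp]: "\<bar>rs_sign b r n\<bar> = 1"
  by (induction b r n rule: rs_sign.induct) (auto simp: abs_mult)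

text \<open>
  The predicate \<open>Q\<close> selects the terms that are kept, so that one definition covers the full polynomial and
  its partial sums. The argument \<open>b\<close> chooses between the two polynomials of a Rudin-Shapiro pair.
\<close>

definition rs_poly :: "bool \<Rightarrow> nat \<Rightarrow> (nat \<Rightarrow> bool) \<Rightarrow> complex \<Rightarrow> complex" where
  "rs_poly b r Q w = (\<Sum>n\<in>{n. n < 2 ^ r \<and> Q n}. of_real (rs_sign b r n) * w ^ n)"

lemma rs_poly_Suc:
  "rs_poly b (Suc r) Q w = rs_poly True r Q w +
     (if b then 1 else - 1) * w ^ (2 ^ r) * rs_poly False r (\<lambda>n. Q (2 ^ r + n)) w"
proof -
  let ?f = "\<lambda>n. of_real (rs_sign b (Suc r) n) * w ^ n"
  have split: "{n. n < 2 ^ Suc r \<and> Q n} =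
      {n. n < 2 ^ r \<and> Q n} \<union> (+) (2 ^ r) ` {n. n < 2 ^ r \<and> Q (2 ^ r + n)}" (is "?A = ?B \<union> ?C")
  proof (intro set_eqI iffI)
    fix n assume n: "n \<in> ?A"
    show "n \<in> ?B \<union> ?C"
    proof (cases "n < 2 ^ r")
      case False
      then have "n = 2 ^ r + (n - 2 ^ r)" by simp
      then show ?thesis using n False by (intro UnI2 image_eqI[of _ _ "n - 2 ^ r"]) auto
    qed (use n in auto)
  qed auto
  have "rs_poly b (Suc r) Q w = sum ?f ?B + sum ?f ?C"
    unfolding rs_poly_def split by (subst sum.union_disjoint) auto
  also have "sum ?f ?B = rs_poly True r Q w"
    unfolding rs_poly_def by (intro sum.cong) auto
  also have "sum ?f ?C = (if b then 1 else - 1) * w ^ (2 ^ r) * rs_poly False r (\<lambda>n. Q (2 ^ r + n)) w"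
    unfolding rs_poly_def
    by (subst sum.reindex) (auto simp: sum_distrib_left power_add sum_negf intro!: sum.cong)
  finally show ?thesis .
qed

lemma parallelogram_cmod: "(cmod (a + b))\<^sup>2 + (cmod (a - b))\<^sup>2 = 2 * ((cmod a)\<^sup>2 + (cmod b)\<^sup>2)"
  by (simp add: cmod_power2 power2_sum power2_diff)

text \<open>
  The parallelogram law doubles the energy of the pair at each step, at every point of the unit circle.
  This is the whole reason for the flatness of the Rudin-Shapiro polynomials.
\<close>

lemma rs_poly_energy:
  assumes "cmod w = 1"
  shows "(cmod (rs_poly True r (\<lambda>_. True) w))\<^sup>2 + (cmod (rs_poly False r (\<lambda>_. True) w))\<^sup>2 = 2 ^ Suc r"
proof (induction r)
  case 0
  have "{n. n < (1::nat)} = {0}" by auto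
  then show ?case by (simp add: rs_poly_def)
next
  case (Suc r)
  let ?p = "rs_poly True r (\<lambda>_. True) w" and ?q = "w ^ (2 ^ r) * rs_poly False r (\<lambda>_. True) w"
  have "cmod ?q = cmod (rs_poly False r (\<lambda>_. True) w)"
    using assms by (simp add: norm_mult norm_power)
  then show ?case
    using parallelogram_cmod[of ?p ?q] Suc by (simp add: rs_poly_Suc)
qed

lemma norm_rs_poly_le:
  assumes "cmod w = 1"
  shows "cmod (rs_poly b r (\<lambda>_. True) w) \<le> sqrt 2 ^ Suc r"
proof -
  have "(cmod (rs_poly b r (\<lambda>_. True) w))\<^sup>2 \<le>
      (cmod (rs_poly True r (\<lambda>_. True) w))\<^sup>2 + (cmod (rs_poly False r (\<lambda>_. True) w))\<^sup>2"
    by (cases b) auto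
  also have "\<dots> = 2 ^ Suc r"
    by (rule rs_poly_energy[OF assms])
  also have "\<dots> = (sqrt 2 ^ Suc r)\<^sup>2"
    by (simp only: power_mult[symmetric] mult.commute[of _ 2]) (simp add: power_mult)
  finally show ?thesis by (rule power2_le_imp_le) simp
qed

text \<open>
  An initial segment of the terms is either contained in the first half of the polynomial, or consists of
  the full first half and an initial segment of the second half. As the full halves have size
  \<open>(\<surd>2)\<^sup>r\<^sup>+\<^sup>1\<close>, the bounds add up to a geometric series; the constant \<open>4\<close> is large enough to close the induction
  because \<open>\<surd>2 + 4 \<le> 4\<surd>2\<close>.
\<close>

lemma norm_rs_poly_initial_le:
  assumes w: "cmod w = 1" and Q: "\<And>m n. m \<le> n \<Longrightarrow> Q n \<Longrightarrow> Q m"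
  shows "cmod (rs_poly b r Q w) \<le> 4 * sqrt 2 ^ r"
  using Q
proof (induction r arbitrary: b Q)
  case 0
  have "{n. n < 2 ^ 0 \<and> Q n} = (if Q 0 then {0} else {})" by auto
  then show ?case by (simp add: rs_poly_def)
next
  case (Suc r)
  have le: "4 * sqrt 2 ^ r \<le> 4 * sqrt 2 ^ Suc r" by simp
  show ?case
  proof (cases "Q (2 ^ r)")
    case True
    have eq: "rs_poly True r Q w = rs_poly True r (\<lambda>_. True) w"
      unfolding rs_poly_def using Suc.prems[OF _ True] by (intro sum.cong) auto
    have "cmod (rs_poly b (Suc r) Q w) \<le>
        cmod (rs_poly True r Q w) + cmod (rs_poly False r (\<lambda>n. Q (2 ^ r + n)) w)"
      unfolding rs_poly_Suc using w by (intro norm_triangle_le) (simp add: norm_mult norm_power)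
    also have "cmod (rs_poly True r Q w) \<le> sqrt 2 ^ Suc r"
      unfolding eq by (rule norm_rs_poly_le[OF w])
    also have "cmod (rs_poly False r (\<lambda>n. Q (2 ^ r + n)) w) \<le> 4 * sqrt 2 ^ r"
    proof (rule Suc.IH)
      fix m n :: nat assume "m \<le> n" "Q (2 ^ r + n)"
      then show "Q (2 ^ r + m)" by (intro Suc.prems[of "2 ^ r + m" "2 ^ r + n"]) auto
    qed
    also have "sqrt 2 ^ Suc r + 4 * sqrt 2 ^ r \<le> 4 * sqrt 2 ^ Suc r"
    proof -
      have "4 \<le> 3 * sqrt 2"
        by (rule power2_le_imp_le) (simp_all add: power_mult_distrib)
      from mult_right_mono[OF this, of "sqrt 2 ^ r"] show ?thesis by simp
    qed
    finally show ?thesis by simp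
  next
    case False
    then have "\<not> Q (2 ^ r + n)" for n using Suc.prems[of "2 ^ r" "2 ^ r + n"] by auto
    then have "rs_poly b (Suc r) Q w = rs_poly True r Q w"
      unfolding rs_poly_Suc by (simp add: rs_poly_def)
    then have "cmod (rs_poly b (Suc r) Q w) \<le> 4 * sqrt 2 ^ r"
      using Suc.IH[of Q True] Suc.prems by simp
    then show ?thesis using le by linarith
  qed
qed

lemma norm_rs_poly_interval_le:
  assumes w: "cmod w = 1" and Q: "\<And>m n. m \<le> n \<Longrightarrow> Q n \<Longrightarrow> Q m"
    and Q': "\<And>m n. m \<le> n \<Longrightarrow> Q' n \<Longrightarrow> Q' m"
  shows "cmod (rs_poly b r (\<lambda>n. Q n \<and> \<not> Q' n) w) \<le> 8 * sqrt 2 ^ r"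
proof -
  have eq: "rs_poly b r (\<lambda>n. Q n \<and> \<not> Q' n) w = rs_poly b r Q w - rs_poly b r (\<lambda>n. Q n \<and> Q' n) w"
  proof -
    have "rs_poly b r Q w = rs_poly b r (\<lambda>n. Q n \<and> \<not> Q' n) w + rs_poly b r (\<lambda>n. Q n \<and> Q' n) w"
      unfolding rs_poly_def by (subst sum.union_disjoint[symmetric]) (auto intro!: sum.cong)
    then show ?thesis by simp
  qed
  have "cmod (rs_poly b r Q w) \<le> 4 * sqrt 2 ^ r"
    by (rule norm_rs_poly_initial_le[OF w Q])
  moreover have "cmod (rs_poly b r (\<lambda>n. Q n \<and> Q' n) w) \<le> 4 * sqrt 2 ^ r"
    by (rule norm_rs_poly_initial_le[OF w]) (use Q Q' in blast)
  ultimately show ?thesis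
    unfolding eq using norm_triangle_ineq4[of "rs_poly b r Q w" "rs_poly b r (\<lambda>n. Q n \<and> Q' n) w"] by linarith
qed

section \<open>Exponentials on the unit interval\<close>

abbreviation unit_leb :: "real measure" where
  "unit_leb \<equiv> lebesgue_on {0..<1}"

definition echar :: "int \<Rightarrow> real \<Rightarrow> complex" where
  "echar m t = cis (2 * pi * of_int m * t)"

lemma echar_0 [simp]: "echar 0 t = 1"
  by (simp add: echar_def)

lemma echar_add: "echar (m + n) t = echar m t * echar n t"
  by (simp add: echar_def cis_mult algebra_simps)

lemma cnj_echar [simp]: "cnj (echar m t) = echar (- m) t"
  by (simp add: echar_def cis_cnj)

lemma norm_echar [simp]: "cmod (echar m t) = 1"
  by (simp add: echar_def)

lemma echar_periodic: "echar m (t - of_int n) = echar m t"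
proof -
  have "cis (2 * pi * of_int m * (t - of_int n)) = cis (2 * pi * of_int m * t) * cis (2 * pi * of_int (- (m * n)))"
    by (simp add: cis_mult algebra_simps)
  also have "cis (2 * pi * of_int (- (m * n))) = 1"
    by (rule cis_multiple_2pi) (rule Ints_of_int)
  finally show ?thesis by (simp add: echar_def)
qed

lemma continuous_on_echar [continuous_intros]: "continuous_on A (echar m)"
  unfolding echar_def by (intro continuous_intros)

lemma finite_measure_unit_leb: "finite_measure unit_leb"
  by (intro finite_measure_lebesgue_on bounded_set_imp_lmeasurable) auto

lemma measurable_unit_leb_lebesgue: "f \<in> borel_measurable lebesgue \<Longrightarrow> f \<in> borel_measurable unit_leb"
  by (rule measurable_restrict_space1)

lemma measurable_unit_leb_borel: "f \<in> borel_measurable borel \<Longrightarrow> f \<in> borel_measurable unit_leb"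
  by (intro measurable_restrict_space1 measurable_completion) simp

lemma borel_measurable_echar [measurable]: "echar m \<in> borel_measurable unit_leb"
  by (intro measurable_unit_leb_borel borel_measurable_continuous_onI continuous_intros)

lemma integrable_unit_leb_bounded:
  fixes f :: "real \<Rightarrow> 'a :: {banach, second_countable_topology}"
  assumes "f \<in> borel_measurable unit_leb" "\<And>t. t \<in> {0..<1} \<Longrightarrow> norm (f t) \<le> B"
  shows "integrable unit_leb f"
  by (rule finite_measure.integrable_const_bound[OF finite_measure_unit_leb _ assms(1), of B])
     (use assms(2) in \<open>auto intro!: AE_I2\<close>)

lemma measure_unit_leb [simp]: "measure unit_leb {0..<1} = 1"
  by (simp add: measure_restrict_space)

lemma integral_unit_leb_const [simp]: "(LINT t|unit_leb. c) = (c :: 'a :: {banach, second_countable_topology})"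
  by simp

lemma integral_echar: "(LINT t|unit_leb. echar m t) = (if m = 0 then 1 else 0)"
proof (cases "m = 0")
  case False
  let ?F = "\<lambda>t. echar m t / (2 * pi * \<i> * of_int m)"
  have "((\<lambda>t. echar m t) has_integral (?F 1 - ?F 0)) {0..1}"
  proof (rule fundamental_theorem_of_calculus)
    fix t :: real
    show "(?F has_vector_derivative echar m t) (at t within {0..1})"
      unfolding echar_def has_vector_derivative_def
      by (rule has_derivative_eq_rhs, (rule derivative_intros)+)
         (use False in \<open>auto simp: scaleR_conv_of_real field_simps\<close>)
  qed simp
  also have "?F 1 - ?F 0 = 0"
    using cis_multiple_2pi[of "of_int m"] by (simp add: echar_def)
  finally have "((\<lambda>t. echar m t) has_integral 0) {0..<1}"
    by (subst has_integral_spike_set_eq[of _ "{0..1}"])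
       (auto intro: negligible_subset[of "{1}"])
  moreover have "integrable unit_leb (echar m)"
    by (rule integrable_unit_leb_bounded[of _ 1]) auto
  ultimately show ?thesis
    using False by (simp add: lebesgue_integral_eq_integral integral_unique)
qed simp

section \<open>Density of the trigonometric polynomials\<close>

definition trig_poly :: "(real \<Rightarrow> complex) \<Rightarrow> bool" where
  "trig_poly T \<longleftrightarrow> (\<exists>M a. finite M \<and> T = (\<lambda>t. \<Sum>m\<in>M. a m * echar m t))"

lemma trig_poly_indexed_sum:
  assumes "finite I"
  shows "trig_poly (\<lambda>t. \<Sum>i\<in>I. a i * echar (\<phi> i) t)"
  unfolding trig_poly_def
proof (intro exI conjI)
  show "(\<lambda>t. \<Sum>i\<in>I. a i * echar (\<phi> i) t) =
      (\<lambda>t. \<Sum>m\<in>\<phi> ` I. (\<Sum>i\<in>{i \<in> I. \<phi> i = m}. a i) * echar m t)"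
    by (subst sum.image_gen[OF assms, of _ \<phi>]) (auto simp: sum_distrib_right intro!: sum.cong)
qed (use assms in auto)

lemma trig_poly_echar: "trig_poly (\<lambda>t. c * echar m t)"
  using trig_poly_indexed_sum[of "{()}" "\<lambda>_. c" "\<lambda>_. m"] by simp

lemma trig_poly_const: "trig_poly (\<lambda>t. c)"
  using trig_poly_echar[of c 0] by simp

lemma trig_poly_add:
  assumes "trig_poly S" "trig_poly T"
  shows "trig_poly (\<lambda>t. S t + T t)"
proof -
  obtain M a N b where *: "finite M" "S = (\<lambda>t. \<Sum>m\<in>M. a m * echar m t)"
      "finite N" "T = (\<lambda>t. \<Sum>m\<in>N. b m * echar m t)"
    using assms unfolding trig_poly_def by blast
  have "trig_poly (\<lambda>t. \<Sum>i\<in>M <+> N. case_sum a b i * echar (case_sum id id i) t)"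
    using * by (intro trig_poly_indexed_sum) auto
  then show ?thesis using * by (simp add: sum.Plus)
qed

lemma trig_poly_mult:
  assumes "trig_poly S" "trig_poly T"
  shows "trig_poly (\<lambda>t. S t * T t)"
proof -
  obtain M a N b where *: "finite M" "S = (\<lambda>t. \<Sum>m\<in>M. a m * echar m t)"
      "finite N" "T = (\<lambda>t. \<Sum>m\<in>N. b m * echar m t)"
    using assms unfolding trig_poly_def by blast
  have "trig_poly (\<lambda>t. \<Sum>i\<in>M \<times> N. (a (fst i) * b (snd i)) * echar (fst i + snd i) t)"
    using * by (intro trig_poly_indexed_sum) auto
  also have "(\<lambda>t. \<Sum>i\<in>M \<times> N. (a (fst i) * b (snd i)) * echar (fst i + snd i) t) = (\<lambda>t. S t * T t)"
    unfolding * sum_product sum.cartesian_product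
    by (auto intro!: sum.cong simp: echar_add)
  finally show ?thesis .
qed

lemma trig_poly_real_polynomial:
  assumes "real_polynomial_function f"
  shows "trig_poly (\<lambda>t. of_real (f (cis (2 * pi * t))))"
  using assms
proof induction
  case (linear f)
  interpret bounded_linear f by fact
  have "of_real (f (cis (2 * pi * t))) =
      (of_real (f 1) / 2 - \<i> * of_real (f \<i>) / 2) * echar 1 t +
      (of_real (f 1) / 2 + \<i> * of_real (f \<i>) / 2) * echar (- 1) t" for t
  proof -
    have "cis (2 * pi * t) = cos (2 * pi * t) *\<^sub>R 1 + sin (2 * pi * t) *\<^sub>R \<i>"
      by (simp add: complex_eq_iff)
    then have "f (cis (2 * pi * t)) = cos (2 * pi * t) * f 1 + sin (2 * pi * t) * f \<i>"
      by (simp only: add scaleR) simp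
    then show ?thesis
      by (simp add: echar_def complex_eq_iff field_simps)
  qed
  then show ?case by (simp only: trig_poly_add trig_poly_echar)
qed (auto simp: trig_poly_const trig_poly_add trig_poly_mult)

text \<open>
  Continuous loops on \<open>[0,1]\<close> are continuous functions on the unit circle, where the Stone-Weierstrass
  theorem gives approximation by polynomials in the real and imaginary parts. On the circle these are
  trigonometric polynomials.
\<close>

lemma trig_poly_uniformly_dense:
  assumes cont: "continuous_on {0..1} \<phi>" and loop: "\<phi> 0 = (\<phi> 1 :: complex)" and "0 < e"
  obtains T where "trig_poly T" "\<And>t. t \<in> {0..1} \<Longrightarrow> cmod (\<phi> t - T t) < e"
proof -
  have "homotopic_loops UNIV \<phi> \<phi>"
    using cont loop by (simp add: homotopic_loops_refl path_def pathfinish_def pathstart_def)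
  then have "continuous_on (sphere 0 1) (\<phi> \<circ> (\<lambda>z. Arg2pi z / (2 * pi)))"
    using homotopic_loops_imp_homotopic_circlemaps homotopic_with_imp_continuous by blast
  from Stone_Weierstrass_polynomial_function[OF compact_sphere this \<open>0 < e\<close>]
  obtain g where g: "polynomial_function g"
      "\<forall>z\<in>sphere 0 1. cmod ((\<phi> \<circ> (\<lambda>z. Arg2pi z / (2 * pi))) z - g z) < e" by blast
  show ?thesis
  proof
    have "real_polynomial_function (\<lambda>z. g z \<bullet> 1)" "real_polynomial_function (\<lambda>z. g z \<bullet> \<i>)"
      using g(1) by (auto simp: polynomial_function_iff_Basis_inner Basis_complex_def)
    then have "trig_poly (\<lambda>t. of_real (g (cis (2 * pi * t)) \<bullet> 1) + \<i> * of_real (g (cis (2 * pi * t)) \<bullet> \<i>))"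
      by (intro trig_poly_add trig_poly_mult trig_poly_const trig_poly_real_polynomial)
    moreover have "of_real (z \<bullet> 1) + \<i> * of_real (z \<bullet> \<i>) = z" for z
      by (simp add: complex_eq_iff)
    ultimately show "trig_poly (\<lambda>t. g (cis (2 * pi * t)))" by simp
  next
    fix t :: real assume t: "t \<in> {0..1}"
    have "\<phi> (Arg2pi (cis (2 * pi * t)) / (2 * pi)) = \<phi> t"
    proof (cases "t = 1")
      case True
      have "Arg2pi 1 = 0" by (rule Arg2pi_unique[of 1]) auto
      then show ?thesis using loop True by simp
    next
      case False
      then have "Arg2pi (cis (2 * pi * t)) = 2 * pi * t"
        using t by (intro Arg2pi_unique[of 1]) (auto simp: cis_conv_exp)
      then show ?thesis by simp
    qed
    then show "cmod (\<phi> t - g (cis (2 * pi * t))) < e"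
      using g(2)[rule_format, of "cis (2 * pi * t)"] by (simp add: dist_norm)
  qed
qed

definition L2_unit :: "(real \<Rightarrow> complex) set" where
  "L2_unit = {H \<in> borel_measurable unit_leb. integrable unit_leb (\<lambda>t. (cmod (H t))\<^sup>2)}"

lemma L2_unitI:
  assumes "H \<in> borel_measurable unit_leb" "\<And>t. t \<in> {0..<1} \<Longrightarrow> cmod (H t) \<le> B"
  shows "H \<in> L2_unit"
proof -
  have "(cmod (H t))\<^sup>2 \<le> B\<^sup>2" if "t \<in> {0..<1}" for t
    using assms(2)[OF that] by (intro power_mono) auto
  then show ?thesis using assms(1) unfolding L2_unit_def
    by (auto intro!: integrable_unit_leb_bounded[of _ "B\<^sup>2"])
qed

lemma cmod_diff_square_le: "(cmod (a - b))\<^sup>2 \<le> 2 * (cmod a)\<^sup>2 + 2 * (cmod b)\<^sup>2"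
proof -
  have "(cmod (a - b))\<^sup>2 \<le> (cmod a + cmod b)\<^sup>2"
    by (intro power_mono norm_triangle_ineq4) simp
  also have "\<dots> \<le> 2 * (cmod a)\<^sup>2 + 2 * (cmod b)\<^sup>2"
    using sum_squares_bound[of "cmod a" "cmod b"] by (simp add: power2_sum)
  finally show ?thesis .
qed

lemma L2_unit_diff:
  assumes "F \<in> L2_unit" "G \<in> L2_unit"
  shows "(\<lambda>t. F t - G t) \<in> L2_unit"
proof -
  have m: "F \<in> borel_measurable unit_leb" "G \<in> borel_measurable unit_leb"
    using assms by (auto simp: L2_unit_def)
  have "integrable unit_leb (\<lambda>t. (cmod (F t - G t))\<^sup>2)"
  proof (rule Bochner_Integration.integrable_bound)
    show "integrable unit_leb (\<lambda>t. 2 * (cmod (F t))\<^sup>2 + 2 * (cmod (G t))\<^sup>2)"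
      using assms by (auto simp: L2_unit_def)
  qed (use m cmod_diff_square_le in \<open>auto intro!: AE_I2\<close>)
  then show ?thesis using m by (simp add: L2_unit_def)
qed

lemma trig_poly_L2_unit:
  assumes "trig_poly T" shows "T \<in> L2_unit"
proof -
  obtain M a where T: "finite M" "T = (\<lambda>t. \<Sum>m\<in>M. a m * echar m t)"
    using assms unfolding trig_poly_def by blast
  show ?thesis
  proof (rule L2_unitI)
    show "cmod (T t) \<le> (\<Sum>m\<in>M. cmod (a m))" for t
      unfolding T by (rule sum_norm_le) (simp add: norm_mult)
  qed (simp add: T)
qed

lemma L2_unit_integrable:
  assumes "H \<in> L2_unit" shows "integrable unit_leb H"
proof (rule Bochner_Integration.integrable_bound)
  show "integrable unit_leb (\<lambda>t. 1 + (cmod (H t))\<^sup>2)"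
    using assms integrable_unit_leb_bounded[of "\<lambda>_. 1 :: real" 1] by (auto simp: L2_unit_def)
  have "x \<le> 1 + x\<^sup>2" for x :: real
  proof -
    have "2 * x \<le> x\<^sup>2 + 1" using sum_squares_bound[of x 1] by simp
    then show ?thesis using zero_le_power2[of x] by linarith
  qed
  then show "AE t in unit_leb. norm (H t) \<le> norm (1 + (cmod (H t))\<^sup>2)" by (intro AE_I2) auto
qed (use assms in \<open>auto simp: L2_unit_def\<close>)

section \<open>Parseval's identity\<close>

definition fourier_coeff :: "(real \<Rightarrow> complex) \<Rightarrow> int \<Rightarrow> complex" where
  "fourier_coeff H m = (LINT t|unit_leb. H t * echar (- m) t)"

text \<open>
  Completing the square. The choice \<open>a = fourier_coeff H\<close> gives Bessel's inequality, and dropping the last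
  term shows that the Bessel defect is at most the squared distance to any trigonometric polynomial.
\<close>

lemma integral_square_diff_trig_poly:
  assumes H: "H \<in> L2_unit" and M: "finite M"
  shows "(LINT t|unit_leb. (cmod (H t - (\<Sum>m\<in>M. a m * echar m t)))\<^sup>2) =
    (LINT t|unit_leb. (cmod (H t))\<^sup>2) - (\<Sum>m\<in>M. (cmod (fourier_coeff H m))\<^sup>2) +
    (\<Sum>m\<in>M. (cmod (fourier_coeff H m - a m))\<^sup>2)"
proof -
  let ?T = "\<lambda>t. \<Sum>m\<in>M. a m * echar m t"
  let ?c = "fourier_coeff H"
  have Hm [measurable]: "H \<in> borel_measurable unit_leb" and H2: "integrable unit_leb (\<lambda>t. (cmod (H t))\<^sup>2)"
    using H by (auto simp: L2_unit_def)
  have He: "integrable unit_leb (\<lambda>t. H t * echar m t)" for m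
    by (rule Bochner_Integration.integrable_bound[OF L2_unit_integrable[OF H]])
       (auto simp: norm_mult)
  have HT: "H t * cnj (?T t) = (\<Sum>m\<in>M. cnj (a m) * (H t * echar (- m) t))" for t
    by (simp add: sum_distrib_left mult_ac)
  have iHT: "integrable unit_leb (\<lambda>t. H t * cnj (?T t))"
    unfolding HT by (intro Bochner_Integration.integrable_sum integrable_mult_right He)
  have intHT: "(LINT t|unit_leb. H t * cnj (?T t)) = (\<Sum>m\<in>M. cnj (a m) * ?c m)"
    unfolding HT fourier_coeff_def
    by (subst Bochner_Integration.integral_sum) (auto intro!: integrable_mult_right He)
  have ie: "integrable unit_leb (echar k)" for k
    by (rule integrable_unit_leb_bounded[of _ 1]) auto
  have TT: "?T t * cnj (?T t) = (\<Sum>m\<in>M. \<Sum>n\<in>M. (a m * cnj (a n)) * echar (m - n) t)" for t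
    using echar_add[of _ "- _"] by (simp add: sum_product mult_ac)
  have intTT: "(LINT t|unit_leb. ?T t * cnj (?T t)) = (\<Sum>m\<in>M. a m * cnj (a m))"
  proof -
    have "(LINT t|unit_leb. ?T t * cnj (?T t)) =
        (\<Sum>m\<in>M. \<Sum>n\<in>M. (a m * cnj (a n)) * (if m = n then 1 else 0))"
      unfolding TT by (simp add: Bochner_Integration.integral_sum integrable_mult_right ie integral_echar
        Bochner_Integration.integrable_sum)
    also have "\<dots> = (\<Sum>m\<in>M. a m * cnj (a m))"
      using M by (simp add: if_distrib cong: if_cong)
    finally show ?thesis .
  qed
  have iTT: "integrable unit_leb (\<lambda>t. ?T t * cnj (?T t))"
    unfolding TT by (intro Bochner_Integration.integrable_sum integrable_mult_right ie)
  have iHH: "integrable unit_leb (\<lambda>t. complex_of_real ((cmod (H t))\<^sup>2))"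
    using H2 by (rule integrable_of_real)
  have eq: "complex_of_real ((cmod (H t - ?T t))\<^sup>2) =
      complex_of_real ((cmod (H t))\<^sup>2) - H t * cnj (?T t) - cnj (H t * cnj (?T t)) + ?T t * cnj (?T t)" for t
    unfolding complex_norm_square by (simp add: algebra_simps)
  have "complex_of_real (LINT t|unit_leb. (cmod (H t - ?T t))\<^sup>2) =
      (LINT t|unit_leb. complex_of_real ((cmod (H t))\<^sup>2)) - (\<Sum>m\<in>M. cnj (a m) * ?c m)
      - cnj (\<Sum>m\<in>M. cnj (a m) * ?c m) + (\<Sum>m\<in>M. a m * cnj (a m))"
  proof -
    have "complex_of_real (LINT t|unit_leb. (cmod (H t - ?T t))\<^sup>2) =
      (LINT t|unit_leb. complex_of_real ((cmod (H t))\<^sup>2) - H t * cnj (?T t)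
        - cnj (H t * cnj (?T t)) + ?T t * cnj (?T t))"
      unfolding integral_complex_of_real[symmetric] eq ..
    also have "\<dots> = (LINT t|unit_leb. complex_of_real ((cmod (H t))\<^sup>2)) - (LINT t|unit_leb. H t * cnj (?T t))
      - (LINT t|unit_leb. cnj (H t * cnj (?T t))) + (LINT t|unit_leb. ?T t * cnj (?T t))"
      by (simp only: Bochner_Integration.integral_add[OF Bochner_Integration.integrable_diff[OF
            Bochner_Integration.integrable_diff[OF iHH iHT] integrable_cnj[OF iHT]] iTT]
          Bochner_Integration.integral_diff[OF Bochner_Integration.integrable_diff[OF iHH iHT] integrable_cnj[OF iHT]]
          Bochner_Integration.integral_diff[OF iHH iHT])
    also have "(LINT t|unit_leb. cnj (H t * cnj (?T t))) = cnj (LINT t|unit_leb. H t * cnj (?T t))"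
      by (rule Bochner_Integration.integral_cnj)
    finally show ?thesis unfolding intHT intTT .
  qed
  also have "\<dots> = complex_of_real ((LINT t|unit_leb. (cmod (H t))\<^sup>2) - (\<Sum>m\<in>M. (cmod (?c m))\<^sup>2) +
    (\<Sum>m\<in>M. (cmod (?c m - a m))\<^sup>2))"
    unfolding integral_complex_of_real of_real_add of_real_diff of_real_sum
    unfolding complex_norm_square
    by (simp add: algebra_simps sum.distrib sum_subtractf)
  finally show ?thesis by (simp only: of_real_eq_iff)
qed

definition approximable :: "(real \<Rightarrow> complex) \<Rightarrow> bool" where
  "approximable H \<longleftrightarrow> (\<forall>e>0. \<exists>T. trig_poly T \<and> (LINT t|unit_leb. (cmod (H t - T t))\<^sup>2) < e)"

text \<open>
  Dominated convergence, in the form in which it is used twice: to remove the truncation of an unbounded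
  function and to pass from continuous functions to their limits almost everywhere.
\<close>

lemma approximable_limit:
  assumes H: "H \<in> L2_unit" and F: "\<And>n. F n \<in> L2_unit" "\<And>n. approximable (F n)"
    and lim: "AE t in unit_leb. (\<lambda>n. F n t) \<longlonglongrightarrow> H t"
    and W: "integrable unit_leb W" "\<And>n t. t \<in> {0..<1} \<Longrightarrow> (cmod (H t - F n t))\<^sup>2 \<le> W t"
  shows "approximable H"
  unfolding approximable_def
proof (intro allI impI)
  fix e :: real assume e: "0 < e"
  have meas [measurable]: "H \<in> borel_measurable unit_leb" "F n \<in> borel_measurable unit_leb" for n
    using H F by (auto simp: L2_unit_def)
  have "(\<lambda>n. LINT t|unit_leb. (cmod (H t - F n t))\<^sup>2) \<longlonglongrightarrow> (LINT t|unit_leb. 0)"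
  proof (rule integral_dominated_convergence[OF _ _ W(1)])
    show "AE t in unit_leb. (\<lambda>n. (cmod (H t - F n t))\<^sup>2) \<longlonglongrightarrow> 0"
      using lim by eventually_elim (auto intro!: tendsto_eq_intros)
    show "AE t in unit_leb. norm ((cmod (H t - F n t))\<^sup>2) \<le> W t" for n
      using W(2) by (auto intro!: AE_I2)
  qed auto
  then have "\<forall>\<^sub>F n in sequentially. (LINT t|unit_leb. (cmod (H t - F n t))\<^sup>2) < e / 4"
    using e by (intro order_tendstoD(2)[where y = 0]) auto
  then obtain n where n: "(LINT t|unit_leb. (cmod (H t - F n t))\<^sup>2) < e / 4"
    by (auto simp: eventually_sequentially)
  obtain T where T: "trig_poly T" "(LINT t|unit_leb. (cmod (F n t - T t))\<^sup>2) < e / 4"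
    using F(2)[of n] e unfolding approximable_def by (meson divide_pos_pos zero_less_numeral)
  note TL = trig_poly_L2_unit[OF T(1)]
  have int: "integrable unit_leb (\<lambda>t. (cmod (H t - T t))\<^sup>2)" "integrable unit_leb (\<lambda>t. (cmod (H t - F n t))\<^sup>2)"
      "integrable unit_leb (\<lambda>t. (cmod (F n t - T t))\<^sup>2)"
    using L2_unit_diff[OF H TL] L2_unit_diff[OF H F(1)] L2_unit_diff[OF F(1) TL] by (auto simp: L2_unit_def)
  have "(LINT t|unit_leb. (cmod (H t - T t))\<^sup>2) \<le>
      (LINT t|unit_leb. 2 * (cmod (H t - F n t))\<^sup>2 + 2 * (cmod (F n t - T t))\<^sup>2)"
  proof (rule integral_mono[OF int(1)])
    show "(cmod (H t - T t))\<^sup>2 \<le> 2 * (cmod (H t - F n t))\<^sup>2 + 2 * (cmod (F n t - T t))\<^sup>2" for t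
      using cmod_diff_square_le[of "H t - F n t" "T t - F n t"] by (simp add: norm_minus_commute)
  qed (use int in auto)
  also have "\<dots> < e" using n T(2) int by simp
  finally show "\<exists>T. trig_poly T \<and> (LINT t|unit_leb. (cmod (H t - T t))\<^sup>2) < e"
    using T(1) by blast
qed

lemma approximable_continuous:
  assumes "continuous_on {0..1} \<phi>" "\<phi> 0 = \<phi> 1" "\<phi> \<in> borel_measurable unit_leb"
  shows "approximable \<phi>"
  unfolding approximable_def
proof (intro allI impI)
  fix e :: real assume e: "0 < e"
  obtain T where T: "trig_poly T" "\<And>t. t \<in> {0..1} \<Longrightarrow> cmod (\<phi> t - T t) < sqrt (e / 2)"
    using trig_poly_uniformly_dense[OF assms(1,2), of "sqrt (e / 2)"] e by auto
  have le: "(cmod (\<phi> t - T t))\<^sup>2 \<le> e / 2" if "t \<in> {0..<1}" for t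
    using T(2)[of t] that e power_mono[of "cmod (\<phi> t - T t)" "sqrt (e / 2)" 2] by simp
  have [measurable]: "T \<in> borel_measurable unit_leb"
    using trig_poly_L2_unit[OF T(1)] by (simp add: L2_unit_def)
  note assms(3)[measurable]
  have "(LINT t|unit_leb. (cmod (\<phi> t - T t))\<^sup>2) \<le> (LINT t|unit_leb. e / 2)"
    by (intro integral_mono integrable_unit_leb_bounded[of _ "e / 2"]) (use le e in auto)
  also have "\<dots> < e" using e by simp
  finally show "\<exists>T. trig_poly T \<and> (LINT t|unit_leb. (cmod (\<phi> t - T t))\<^sup>2) < e"
    using T(1) by blast
qed

text \<open>
  The radial retraction of the plane onto the disc of radius \<open>r\<close>.
\<close>

definition clamp_norm :: "real \<Rightarrow> complex \<Rightarrow> complex" where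
  "clamp_norm r z = (r / max r (cmod z)) *\<^sub>R z"

lemma clamp_norm:
  assumes "0 < r"
  shows "cmod (clamp_norm r z) \<le> r" "cmod (z - clamp_norm r z) \<le> cmod z"
    "cmod z \<le> r \<Longrightarrow> clamp_norm r z = z" "continuous_on UNIV (clamp_norm r)"
proof -
  show "cmod (clamp_norm r z) \<le> r"
    using assms by (auto simp: clamp_norm_def max_def field_simps)
  show "cmod z \<le> r \<Longrightarrow> clamp_norm r z = z"
    using assms by (auto simp: clamp_norm_def max_def)
  have "z - clamp_norm r z = (1 - r / max r (cmod z)) *\<^sub>R z"
    by (simp add: clamp_norm_def algebra_simps)
  moreover have "\<bar>1 - r / max r (cmod z)\<bar> \<le> 1"
    using assms by (auto simp: max_def abs_if divide_le_eq)
  ultimately show "cmod (z - clamp_norm r z) \<le> cmod z"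
    by (simp add: mult_left_le_one_le)
  show "continuous_on UNIV (clamp_norm r)"
    unfolding clamp_norm_def using assms by (intro continuous_intros) (auto simp: max_def)
qed

text \<open>
  A measurable function is a limit almost everywhere of continuous functions. Multiplying these by a
  cut-off that vanishes at \<open>0\<close> and \<open>1\<close> makes them loops, and the retraction onto a disc makes them uniformly
  bounded.
\<close>

lemma approximable_bounded:
  assumes H [measurable]: "H \<in> borel_measurable unit_leb" and r: "0 < r" and bd: "\<And>t. cmod (H t) \<le> r"
  shows "approximable H"
proof -
  have "(\<lambda>t. if t \<in> {0..<1} then H t else 0) \<in> borel_measurable lebesgue"
    using H by (intro borel_measurable_if_I) auto
  then have "(\<lambda>t. if t \<in> {0..<1} then H t else 0) measurable_on UNIV"
    by (rule lebesgue_measurable_imp_measurable_on[where S = UNIV, simplified])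
  then obtain N \<psi> where N: "negligible N" and \<psi>: "\<And>n. continuous_on UNIV (\<psi> n)"
    and lim: "\<And>t. t \<notin> N \<Longrightarrow> (\<lambda>n. \<psi> n t) \<longlonglongrightarrow> (if t \<in> {0..<1} then H t else 0)"
    unfolding measurable_on_def by auto
  \<comment> \<open>a cut-off that vanishes at \<open>0\<close> and \<open>1\<close> and is eventually \<open>1\<close> at each point in between\<close>
  define \<kappa> :: "nat \<Rightarrow> real \<Rightarrow> real" where "\<kappa> n t = min 1 (real n * \<bar>t * (1 - t)\<bar>)" for n t
  define F where "F n t = \<kappa> n t *\<^sub>R clamp_norm r (\<psi> n t)" for n t
  have contF: "continuous_on UNIV (F n)" for n
    unfolding F_def \<kappa>_def
    by (intro continuous_intros continuous_on_compose2[OF clamp_norm(4)[OF r]] \<psi>) auto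
  then have measF: "F n \<in> borel_measurable unit_leb" for n
    by (intro measurable_unit_leb_borel borel_measurable_continuous_onI)
  have bdF: "cmod (F n t) \<le> r" for n t
  proof -
    have "\<bar>\<kappa> n t\<bar> \<le> 1" unfolding \<kappa>_def by auto
    then have "cmod (F n t) \<le> 1 * cmod (clamp_norm r (\<psi> n t))"
      unfolding F_def norm_scaleR by (intro mult_right_mono) auto
    then show ?thesis using clamp_norm(1)[OF r, of "\<psi> n t"] by simp
  qed
  show ?thesis
  proof (rule approximable_limit[where F = F and W = "\<lambda>_. 4 * r\<^sup>2"])
    show "H \<in> L2_unit" using bd by (intro L2_unitI H)
    show "F n \<in> L2_unit" for n using bdF measF by (intro L2_unitI)
    show "approximable (F n)" for n
      using continuous_on_subset[OF contF] measF by (intro approximable_continuous) (auto simp: F_def \<kappa>_def)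
    show "integrable unit_leb (\<lambda>_. 4 * r\<^sup>2)"
      by (rule integrable_unit_leb_bounded[of _ "4 * r\<^sup>2"]) auto
    show "(cmod (H t - F n t))\<^sup>2 \<le> 4 * r\<^sup>2" for n t
      using cmod_diff_square_le[of "H t" "F n t"] power_mono[OF bd[of t], of 2] power_mono[OF bdF[of n t], of 2]
      by simp
    have "negligible (insert 0 N)" using N by simp
    then have "AE t in lebesgue. t \<notin> insert 0 N"
      by (metis AE_not_in negligible_iff_null_sets)
    then have "AE t in unit_leb. t \<notin> insert 0 N"
      by (auto simp: AE_restrict_space_iff elim: eventually_mono)
    moreover have "AE t in unit_leb. t \<in> {0..<1}" by (auto intro!: AE_I2)
    ultimately show "AE t in unit_leb. (\<lambda>n. F n t) \<longlonglongrightarrow> H t"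
    proof eventually_elim
      case (elim t)
      then have t: "0 < t" "t < 1" "t \<notin> N" by auto
      have "(\<lambda>n. clamp_norm r (\<psi> n t)) \<longlonglongrightarrow> clamp_norm r (H t)"
        using continuous_on_tendsto_compose[OF clamp_norm(4)[OF r] lim[OF t(3)]] t by auto
      also have "clamp_norm r (H t) = H t" using bd r by (simp add: clamp_norm)
      finally have 1: "(\<lambda>n. clamp_norm r (\<psi> n t)) \<longlonglongrightarrow> H t" .
      have "0 < \<bar>t * (1 - t)\<bar>" using t by simp
      then obtain n0 :: nat where n0: "1 < of_nat n0 * \<bar>t * (1 - t)\<bar>"
        using ex_less_of_nat_mult by blast
      have "\<forall>\<^sub>F n in sequentially. \<kappa> n t = 1"
        using eventually_ge_at_top[of n0]
      proof eventually_elim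
        case (elim n)
        then have "of_nat n0 * \<bar>t * (1 - t)\<bar> \<le> of_nat n * \<bar>t * (1 - t)\<bar>"
          by (intro mult_right_mono) auto
        then show ?case using n0 unfolding \<kappa>_def by linarith
      qed
      then have "(\<lambda>n. \<kappa> n t) \<longlonglongrightarrow> 1" by (rule tendsto_eventually)
      from tendsto_scaleR[OF this 1] show ?case by (simp add: F_def)
    qed
  qed
qed

lemma L2_unit_approximable:
  assumes H: "H \<in> L2_unit"
  shows "approximable H"
proof -
  have Hm [measurable]: "H \<in> borel_measurable unit_leb" and H2: "integrable unit_leb (\<lambda>t. (cmod (H t))\<^sup>2)"
    using H by (auto simp: L2_unit_def)
  define F where "F n t = clamp_norm (real (Suc n)) (H t)" for n t
  have measF: "F n \<in> borel_measurable unit_leb" for n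
    unfolding F_def
    by (rule measurable_compose[OF Hm borel_measurable_continuous_onI]) (intro clamp_norm; simp)
  have bdF: "cmod (F n t) \<le> real (Suc n)" for n t
    unfolding F_def by (intro clamp_norm) simp
  show ?thesis
  proof (rule approximable_limit[where F = F, OF H _ _ _ H2])
    show "F n \<in> L2_unit" for n using measF bdF by (rule L2_unitI)
    show "approximable (F n)" for n
      by (rule approximable_bounded[of _ "real (Suc n)"]) (use bdF measF in auto)
    show "AE t in unit_leb. (\<lambda>n. F n t) \<longlonglongrightarrow> H t"
    proof (intro AE_I2 tendsto_eventually)
      fix t
      obtain n0 :: nat where n0: "cmod (H t) \<le> real n0" using real_arch_simple by blast
      show "\<forall>\<^sub>F n in sequentially. F n t = H t"
        using eventually_ge_at_top[of n0] by eventually_elim (use n0 in \<open>auto simp: F_def clamp_norm\<close>)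
    qed
    show "(cmod (H t - F n t))\<^sup>2 \<le> (cmod (H t))\<^sup>2" for n t
      unfolding F_def by (intro power_mono clamp_norm) auto
  qed
qed

theorem parseval:
  assumes H: "H \<in> L2_unit"
  shows "((\<lambda>m. (cmod (fourier_coeff H m))\<^sup>2) has_sum (LINT t|unit_leb. (cmod (H t))\<^sup>2)) UNIV"
  unfolding has_sum_def
proof (rule tendstoI)
  fix e :: real assume e: "0 < e"
  let ?I = "LINT t|unit_leb. (cmod (H t))\<^sup>2"
  obtain T where T: "trig_poly T" "(LINT t|unit_leb. (cmod (H t - T t))\<^sup>2) < e"
    using L2_unit_approximable[OF H] e unfolding approximable_def by blast
  obtain M a where M: "finite M" "T = (\<lambda>t. \<Sum>m\<in>M. a m * echar m t)"
    using T(1) unfolding trig_poly_def by blast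
  have "0 \<le> (\<Sum>m\<in>M. (cmod (fourier_coeff H m - a m))\<^sup>2)" by (intro sum_nonneg) auto
  then have lower: "?I - e < (\<Sum>m\<in>M. (cmod (fourier_coeff H m))\<^sup>2)"
    using T(2) unfolding M integral_square_diff_trig_poly[OF H M(1)] by linarith
  have upper: "(\<Sum>m\<in>N. (cmod (fourier_coeff H m))\<^sup>2) \<le> ?I" if "finite N" for N
  proof -
    have "0 \<le> (LINT t|unit_leb. (cmod (H t - (\<Sum>m\<in>N. fourier_coeff H m * echar m t)))\<^sup>2)"
      by simp
    then show ?thesis unfolding integral_square_diff_trig_poly[OF H that] by simp
  qed
  show "\<forall>\<^sub>F N in finite_subsets_at_top UNIV. dist (\<Sum>m\<in>N. (cmod (fourier_coeff H m))\<^sup>2) ?I < e"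
    unfolding eventually_finite_subsets_at_top
  proof (intro exI[of _ M] conjI allI impI)
    fix N :: "int set" assume N: "finite N \<and> M \<subseteq> N \<and> N \<subseteq> UNIV"
    then have "(\<Sum>m\<in>M. (cmod (fourier_coeff H m))\<^sup>2) \<le> (\<Sum>m\<in>N. (cmod (fourier_coeff H m))\<^sup>2)"
      by (intro sum_mono2) auto
    then show "dist (\<Sum>m\<in>N. (cmod (fourier_coeff H m))\<^sup>2) ?I < e"
      using lower upper[of N] N by (simp add: dist_real_def)
  qed (use M in auto)
qed

section \<open>Folding the line onto the unit interval\<close>

abbreviation int_count :: "int measure" where "int_count \<equiv> count_space UNIV"

text \<open>
  Both sides default to \<open>0\<close> when the series does not converge absolutely, so measurability of sums over
  fibers follows from measurability of parametrised integrals.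
\<close>

lemma infsum_eq_count_space_integral:
  fixes f :: "'i \<Rightarrow> complex"
  shows "infsum f UNIV = (LINT i|count_space UNIV. f i)"
proof (cases "f summable_on UNIV")
  case True
  then have "Infinite_Set_Sum.abs_summable_on f UNIV"
    by (simp add: summable_on_iff_abs_summable_on_complex abs_summable_equivalent)
  then show ?thesis using infsetsum_infsum[of f UNIV] by (simp add: infsetsum_def)
next
  case False
  then have "\<not> integrable (count_space UNIV) f"
    by (simp add: summable_on_iff_abs_summable_on_complex abs_summable_equivalent abs_summable_on_def)
  with False show ?thesis by (simp add: infsum_not_exists not_integrable_integral_eq)
qed

lemma summable_iff_integrable_count_space:
  fixes f :: "'i \<Rightarrow> complex"
  shows "f summable_on UNIV \<longleftrightarrow> integrable (count_space UNIV) f"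
  by (simp add: summable_on_iff_abs_summable_on_complex abs_summable_equivalent abs_summable_on_def)

lemma pair_sigma_finite_unit_int: "pair_sigma_finite unit_leb int_count"
proof -
  interpret finite_measure unit_leb by (rule finite_measure_unit_leb)
  show ?thesis
    by (intro pair_sigma_finite.intro sigma_finite_measure_axioms sigma_finite_measure_count_space_countable) auto
qed

lemma measurable_shift_lebesgue: "(\<lambda>t. t - c) \<in> lebesgue \<rightarrow>\<^sub>M lebesgue" for c :: real
  using lebesgue_affine_measurable[where 'a = real, of "\<lambda>_. 1" "- c"] by simp

lemma measurable_pair_unit_int:
  assumes "\<And>n. (\<lambda>t. f (t, n)) \<in> unit_leb \<rightarrow>\<^sub>M N"
  shows "f \<in> unit_leb \<Otimes>\<^sub>M int_count \<rightarrow>\<^sub>M N"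
proof -
  have "(\<lambda>p. (\<lambda>n p. f (fst p, n)) (snd p) p) \<in> unit_leb \<Otimes>\<^sub>M int_count \<rightarrow>\<^sub>M N"
    by (rule measurable_compose_countable[OF measurable_compose[OF measurable_fst assms] measurable_snd])
  then show ?thesis by simp
qed

lemma nn_integral_fold:
  assumes u [measurable]: "u \<in> borel_measurable lebesgue"
  shows "(\<integral>\<^sup>+x. u x \<partial>lebesgue) = (\<integral>\<^sup>+t. (\<integral>\<^sup>+n. u (t - of_int n) \<partial>int_count) \<partial>unit_leb)"
proof -
  have um: "(\<lambda>t. u (t - c)) \<in> borel_measurable lebesgue" for c
    by (rule measurable_compose[OF measurable_shift_lebesgue u])
  let ?I = "\<lambda>n::int. {- of_int n ..< 1 - of_int n :: real}"
  have I [measurable]: "?I n \<in> sets lebesgue" for n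
    by (intro sets_completionI_sets) simp
  have one: "(\<integral>\<^sup>+n. u x * indicator (?I n) x \<partial>int_count) = u x" for x
  proof -
    have eq: "x \<in> ?I n \<longleftrightarrow> n = - \<lfloor>x\<rfloor>" for n
      using floor_eq_iff[of x "- n"] by auto
    have "(\<integral>\<^sup>+n. u x * indicator (?I n) x \<partial>int_count) = (\<integral>\<^sup>+n. u x * indicator {- \<lfloor>x\<rfloor>} n \<partial>int_count)"
      by (intro nn_integral_cong) (auto simp: indicator_def eq simp del: atLeastLessThan_iff)
    also have "\<dots> = u x" by (simp add: nn_integral_cmult)
    finally show ?thesis .
  qed
  have shift: "(\<integral>\<^sup>+x. u x * indicator (?I n) x \<partial>lebesgue) = (\<integral>\<^sup>+t. u (t - of_int n) \<partial>unit_leb)" for n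
  proof -
    have "(\<integral>\<^sup>+x. u x * indicator (?I n) x \<partial>lebesgue) =
        (\<integral>\<^sup>+t. u (- of_int n + 1 * t) * indicator (?I n) (- of_int n + 1 * t) \<partial>lebesgue)"
      by (subst nn_integral_real_affine_lebesgue[where c = 1 and t = "- of_int n"]) auto
    also have "\<dots> = (\<integral>\<^sup>+t. u (t - of_int n) * indicator {0..<1} t \<partial>lebesgue)"
      by (intro nn_integral_cong) (auto simp: indicator_def)
    also have "\<dots> = (\<integral>\<^sup>+t. u (t - of_int n) \<partial>unit_leb)"
      by (simp add: nn_integral_restrict_space)
    finally show ?thesis .
  qed
  have "(\<integral>\<^sup>+x. u x \<partial>lebesgue) = (\<integral>\<^sup>+x. (\<integral>\<^sup>+n. u x * indicator (?I n) x \<partial>int_count) \<partial>lebesgue)"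
    by (simp only: one)
  also have "\<dots> = (\<integral>\<^sup>+n. (\<integral>\<^sup>+x. u x * indicator (?I n) x \<partial>lebesgue) \<partial>int_count)"
    by (rule nn_integral_count_space_nn_integral) auto
  also have "\<dots> = (\<integral>\<^sup>+n. (\<integral>\<^sup>+t. u (t - of_int n) \<partial>unit_leb) \<partial>int_count)"
    by (simp only: shift)
  also have "\<dots> = (\<integral>\<^sup>+t. (\<integral>\<^sup>+n. u (t - of_int n) \<partial>int_count) \<partial>unit_leb)"
    by (rule nn_integral_count_space_nn_integral[symmetric])
       (auto intro: measurable_unit_leb_lebesgue um)
  finally show ?thesis .
qed

lemma measurable_fold_map: "(\<lambda>(t, n). t - of_int n) \<in> unit_leb \<Otimes>\<^sub>M int_count \<rightarrow>\<^sub>M lebesgue"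
  by (rule measurable_pair_unit_int) (simp add: measurable_restrict_space1[OF measurable_shift_lebesgue])

text \<open>
  The translates of \<open>[0,1)\<close> by integers tile the line, so the Lebesgue measure is the image of a product with
  a counting measure. All statements about summation over fibers then become instances of Fubini's
  theorem.
\<close>

lemma lebesgue_eq_distr_fold:
  "lebesgue = distr (unit_leb \<Otimes>\<^sub>M int_count) lebesgue (\<lambda>(t, n). t - of_int n)"
proof (rule measure_eqI)
  interpret pair_sigma_finite unit_leb int_count by (rule pair_sigma_finite_unit_int)
  fix A :: "real set" assume A [measurable]: "A \<in> sets lebesgue"
  note measurable_fold_map [measurable]
  have "emeasure (distr (unit_leb \<Otimes>\<^sub>M int_count) lebesgue (\<lambda>(t, n). t - of_int n)) A =
      (\<integral>\<^sup>+x. indicator A x \<partial>distr (unit_leb \<Otimes>\<^sub>M int_count) lebesgue (\<lambda>(t, n). t - of_int n))"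
    by simp
  also have "\<dots> = (\<integral>\<^sup>+p. indicator A (case p of (t, n) \<Rightarrow> t - of_int n) \<partial>(unit_leb \<Otimes>\<^sub>M int_count))"
    by (rule nn_integral_distr) auto
  also have "\<dots> = (\<integral>\<^sup>+t. (\<integral>\<^sup>+n. indicator A (t - of_int n) \<partial>int_count) \<partial>unit_leb)"
    by (subst M2.nn_integral_fst[symmetric]) (auto simp: case_prod_beta)
  also have "\<dots> = emeasure lebesgue A"
    by (subst nn_integral_fold[symmetric]) auto
  finally show "emeasure lebesgue A = emeasure (distr (unit_leb \<Otimes>\<^sub>M int_count) lebesgue (\<lambda>(t, n). t - of_int n)) A"
    by simp
qed simp

lemma integral_fold:
  fixes u :: "real \<Rightarrow> complex"
  assumes u: "integrable lebesgue u"
  shows "AE t in unit_leb. (\<lambda>n. u (t - of_int n)) summable_on UNIV"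
    and "integrable unit_leb (\<lambda>t. \<Sum>\<^sub>\<infinity>n::int. u (t - of_int n))"
    and "(LINT x|lebesgue. u x) = (LINT t|unit_leb. (\<Sum>\<^sub>\<infinity>n::int. u (t - of_int n)))"
proof -
  interpret pair_sigma_finite unit_leb int_count by (rule pair_sigma_finite_unit_int)
  let ?P = "unit_leb \<Otimes>\<^sub>M int_count" and ?s = "\<lambda>(t, n). t - real_of_int n"
  have um: "u \<in> borel_measurable lebesgue" using u by auto
  have int: "integrable ?P (\<lambda>p. u (?s p))"
    using u integrable_distr_eq[OF measurable_fold_map um] by (simp flip: lebesgue_eq_distr_fold)
  show "AE t in unit_leb. (\<lambda>n. u (t - of_int n)) summable_on UNIV"
    using AE_integrable_fst'[OF int] by (simp add: summable_iff_integrable_count_space)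
  show "integrable unit_leb (\<lambda>t. \<Sum>\<^sub>\<infinity>n::int. u (t - of_int n))"
    using integrable_fst'[OF int] by (simp add: infsum_eq_count_space_integral)
  have "(LINT x|lebesgue. u x) = (LINT p|?P. u (?s p))"
    using integral_distr[OF measurable_fold_map um] by (simp flip: lebesgue_eq_distr_fold)
  also have "\<dots> = (LINT t|unit_leb. (\<Sum>\<^sub>\<infinity>n::int. u (t - of_int n)))"
    using integral_fst'[OF int] by (simp add: infsum_eq_count_space_integral)
  finally show "(LINT x|lebesgue. u x) = (LINT t|unit_leb. (\<Sum>\<^sub>\<infinity>n::int. u (t - of_int n)))" .
qed

section \<open>Autocorrelations and Toeplitz forms\<close>

definition corr :: "(int \<Rightarrow> complex) \<Rightarrow> int \<Rightarrow> complex" where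
  "corr x k = (\<Sum>\<^sub>\<infinity>n. x n * cnj (x (n + k)))"

definition square_summable :: "(int \<Rightarrow> complex) \<Rightarrow> bool" where
  "square_summable x \<longleftrightarrow> (\<lambda>n. (cmod (x n))\<^sup>2) summable_on UNIV"

lemma bij_betw_int_add: "bij_betw (\<lambda>n. n + a) UNIV (UNIV :: int set)"
  by (rule bij_betwI[where g = "\<lambda>n. n - a"]) auto

lemma bij_betw_int_reflect: "bij_betw (\<lambda>n. a - n) UNIV (UNIV :: int set)"
  by (rule bij_betwI[where g = "\<lambda>n. a - n"]) auto

lemma square_summable_product:
  assumes "square_summable x"
  shows "(\<lambda>n. x n * cnj (x (n + k))) summable_on UNIV"
proof (rule abs_summable_summable, rule summable_on_comparison_test)
  have "(\<lambda>n. (cmod (x (n + k)))\<^sup>2) summable_on UNIV"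
    using assms summable_on_reindex_bij_betw[OF bij_betw_int_add, of "\<lambda>n. (cmod (x n))\<^sup>2" k]
    by (simp add: square_summable_def)
  then show "(\<lambda>n. (cmod (x n))\<^sup>2 + (cmod (x (n + k)))\<^sup>2) summable_on UNIV"
    using assms unfolding square_summable_def by (intro summable_on_add)
  fix n
  have "2 * (cmod (x n) * cmod (x (n + k))) \<le> (cmod (x n))\<^sup>2 + (cmod (x (n + k)))\<^sup>2"
    using sum_squares_bound[of "cmod (x n)" "cmod (x (n + k))"] by simp
  moreover have "0 \<le> cmod (x n) * cmod (x (n + k))" by simp
  ultimately show "cmod (x n * cnj (x (n + k))) \<le> (cmod (x n))\<^sup>2 + (cmod (x (n + k)))\<^sup>2"
    unfolding norm_mult complex_mod_cnj by linarith
qed auto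

lemma corr_0:
  assumes "square_summable x"
  shows "corr x 0 = of_real (\<Sum>\<^sub>\<infinity>n. (cmod (x n))\<^sup>2)"
proof -
  have "((\<lambda>n. complex_of_real ((cmod (x n))\<^sup>2)) has_sum of_real (\<Sum>\<^sub>\<infinity>n. (cmod (x n))\<^sup>2)) UNIV"
    using assms unfolding square_summable_def by (intro has_sum_of_real has_sum_infsum)
  then show ?thesis
    unfolding corr_def complex_norm_square add_0_right by (rule infsumI)
qed

lemma has_sum_finite_sum:
  fixes f :: "'i \<Rightarrow> 'b \<Rightarrow> complex"
  assumes "finite I" "\<And>i. i \<in> I \<Longrightarrow> (f i has_sum s i) A"
  shows "((\<lambda>x. \<Sum>i\<in>I. f i x) has_sum (\<Sum>i\<in>I. s i)) A"
  using assms by (induction I rule: finite_induct) (auto intro!: has_sum_add)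

lemma corr_has_sum:
  assumes "square_summable x"
  shows "((\<lambda>n. x (a - n) * cnj (x (b - n))) has_sum corr x (b - a)) UNIV"
proof -
  have "((\<lambda>n. x n * cnj (x (n + (b - a)))) has_sum corr x (b - a)) UNIV"
    using square_summable_product[OF assms] unfolding corr_def by (rule has_sum_infsum)
  then have "((\<lambda>n. x (a - n) * cnj (x (a - n + (b - a)))) has_sum corr x (b - a)) UNIV"
    using has_sum_reindex_bij_betw[OF bij_betw_int_reflect, of "\<lambda>n. x n * cnj (x (n + (b - a)))" a] by simp
  then show ?thesis by simp
qed

lemma cnj_corr:
  assumes "square_summable x"
  shows "cnj (corr x k) = corr x (- k)"
proof -
  have "((\<lambda>n. x (0 - n) * cnj (x (k - n))) has_sum corr x k) UNIV"
    using corr_has_sum[OF assms, of 0 k] by simp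
  then have "((\<lambda>n. x (k - n) * cnj (x (0 - n))) has_sum cnj (corr x k)) UNIV"
    by (subst (asm) has_sum_cnj_iff[symmetric]) (simp add: mult.commute)
  then show ?thesis using corr_has_sum[OF assms, of k 0] by (auto dest: has_sum_unique)
qed

text \<open>
  The autocorrelation of the restriction of \<open>x\<close> to \<open>A\<close>.
\<close>

definition corr_trunc :: "(int \<Rightarrow> complex) \<Rightarrow> int set \<Rightarrow> int \<Rightarrow> complex" where
  "corr_trunc x A k = (\<Sum>n\<in>A. if n + k \<in> A then x n * cnj (x (n + k)) else 0)"

lemma corr_trunc_tendsto:
  assumes "square_summable x"
  shows "((\<lambda>A. corr_trunc x A k) \<longlongrightarrow> corr x k) (finite_subsets_at_top UNIV)"
proof -
  let ?f = "\<lambda>n. x n * cnj (x (n + k))"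
  \<comment> \<open>the indices that contribute to the truncated sum exhaust the integers\<close>
  have "filterlim (\<lambda>A. {n \<in> A. n + k \<in> A}) (finite_subsets_at_top UNIV) (finite_subsets_at_top UNIV)"
    unfolding filterlim_iff eventually_finite_subsets_at_top
  proof (intro allI impI)
    fix P :: "int set \<Rightarrow> bool"
    assume "\<exists>X. finite X \<and> X \<subseteq> UNIV \<and> (\<forall>Y. finite Y \<and> X \<subseteq> Y \<and> Y \<subseteq> UNIV \<longrightarrow> P Y)"
    then obtain X where X: "finite X" "\<And>Y. finite Y \<Longrightarrow> X \<subseteq> Y \<Longrightarrow> P Y" by auto
    show "\<exists>X. finite X \<and> X \<subseteq> UNIV \<and> (\<forall>Y. finite Y \<and> X \<subseteq> Y \<and> Y \<subseteq> UNIV \<longrightarrow> P {n \<in> Y. n + k \<in> Y})"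
      using X(1) by (intro exI[of _ "X \<union> (\<lambda>n. n + k) ` X"]) (auto intro!: X(2))
  qed
  moreover have "(sum ?f \<longlongrightarrow> corr x k) (finite_subsets_at_top UNIV)"
    using square_summable_product[OF assms] unfolding corr_def by (rule infsum_tendsto)
  ultimately have "((\<lambda>A. sum ?f {n \<in> A. n + k \<in> A}) \<longlongrightarrow> corr x k) (finite_subsets_at_top UNIV)"
    using filterlim_compose by blast
  then show ?thesis
  proof (rule Lim_transform_eventually)
    show "\<forall>\<^sub>F A in finite_subsets_at_top UNIV. sum ?f {n \<in> A. n + k \<in> A} = corr_trunc x A k"
      unfolding corr_trunc_def by (rule eventually_finite_subsets_at_top_weakI) (simp add: sum.inter_filter)
  qed
qed

text \<open>
  For a finitely supported sequence the Toeplitz form is the integral of its symbol against the nonnegative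
  function \<open>|X|\<^sup>2\<close>, by orthogonality of the exponentials.
\<close>

lemma integral_trig_form:
  fixes \<gamma> x :: "int \<Rightarrow> complex"
  assumes "finite K" "finite A"
  defines "X \<equiv> \<lambda>t. \<Sum>n\<in>A. x n * echar (- n) t"
  shows "(LINT t|unit_leb. (\<Sum>k\<in>K. \<gamma> k * echar k t) * (cnj (X t) * X t)) =
    (\<Sum>k\<in>K. \<gamma> k * cnj (corr_trunc x A k))"
proof -
  have ie: "integrable unit_leb (echar k)" for k
    by (rule integrable_unit_leb_bounded[of _ 1]) auto
  have XX: "cnj (X t) * X t = (\<Sum>n\<in>A. \<Sum>m\<in>A. (cnj (x n) * x m) * echar (n - m) t)" for t
  proof -
    have "(cnj (x n) * x m) * echar (n - m) t = cnj (x n * echar (- n) t) * (x m * echar (- m) t)" for n m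
      using echar_add[of n "- m" t] by (simp add: mult_ac)
    then show ?thesis by (simp only: X_def cnj_sum sum_product)
  qed
  have "(LINT t|unit_leb. (\<Sum>k\<in>K. \<gamma> k * echar k t) * (cnj (X t) * X t)) =
      (LINT t|unit_leb. (\<Sum>k\<in>K. \<Sum>n\<in>A. \<Sum>m\<in>A. (\<gamma> k * (cnj (x n) * x m)) * echar (k + n - m) t))"
  proof (intro Bochner_Integration.integral_cong refl)
    fix t
    have "(\<gamma> k * (cnj (x n) * x m)) * echar (k + n - m) t =
        (\<gamma> k * echar k t) * ((cnj (x n) * x m) * echar (n - m) t)" for k n m
      using echar_add[of k "n - m" t] by (simp add: add_diff_eq mult_ac)
    then show "(\<Sum>k\<in>K. \<gamma> k * echar k t) * (cnj (X t) * X t) =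
        (\<Sum>k\<in>K. \<Sum>n\<in>A. \<Sum>m\<in>A. (\<gamma> k * (cnj (x n) * x m)) * echar (k + n - m) t)"
      unfolding XX sum_distrib_right by (simp only: sum_distrib_left)
  qed
  also have "\<dots> = (\<Sum>k\<in>K. \<Sum>n\<in>A. \<Sum>m\<in>A. (\<gamma> k * (cnj (x n) * x m)) * (if k + n - m = 0 then 1 else 0))"
    by (simp add: Bochner_Integration.integral_sum Bochner_Integration.integrable_sum ie
      integrable_mult_right integral_echar)
  also have "\<dots> = (\<Sum>k\<in>K. \<Sum>n\<in>A. if n + k \<in> A then \<gamma> k * (cnj (x n) * x (n + k)) else 0)"
  proof (intro sum.cong refl)
    fix k n
    have "(\<Sum>m\<in>A. (\<gamma> k * (cnj (x n) * x m)) * (if k + n - m = 0 then 1 else 0)) =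
        (\<Sum>m\<in>A. if m = n + k then \<gamma> k * (cnj (x n) * x m) else 0)"
      by (intro sum.cong) auto
    then show "(\<Sum>m\<in>A. (\<gamma> k * (cnj (x n) * x m)) * (if k + n - m = 0 then 1 else 0)) =
        (if n + k \<in> A then \<gamma> k * (cnj (x n) * x (n + k)) else 0)"
      using assms by simp
  qed
  also have "\<dots> = (\<Sum>k\<in>K. \<gamma> k * cnj (corr_trunc x A k))"
    unfolding corr_trunc_def cnj_sum sum_distrib_left by (intro sum.cong) auto
  finally show ?thesis .
qed

text \<open>
  The integral representation gives the bound for finite truncations of \<open>x\<close>. A finite number of
  autocorrelation coefficients is continuous under truncation, so the bound persists in the limit.
\<close>

lemma toeplitz_form_bound:
  assumes K: "finite K" and x: "square_summable x"
    and C: "\<And>t. cmod (\<Sum>k\<in>K. \<gamma> k * echar k t) \<le> C"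
  shows "cmod (\<Sum>k\<in>K. \<gamma> k * cnj (corr x k)) \<le> C * (\<Sum>\<^sub>\<infinity>n. (cmod (x n))\<^sup>2)"
proof -
  have fin: "cmod (\<Sum>k\<in>K. \<gamma> k * cnj (corr_trunc x A k)) \<le> C * (\<Sum>n\<in>A. (cmod (x n))\<^sup>2)"
    if A: "finite A" for A
  proof -
    let ?X = "\<lambda>t. \<Sum>n\<in>A. x n * echar (- n) t"
    let ?T = "\<lambda>t. \<Sum>k\<in>K. \<gamma> k * echar k t"
    have cX: "continuous_on UNIV ?X" and cT: "continuous_on UNIV ?T"
      by (intro continuous_intros)+
    have bd: "cmod (?X t) \<le> (\<Sum>n\<in>A. cmod (x n))" for t
      by (rule sum_norm_le) (simp add: norm_mult)
    have iX: "integrable unit_leb (\<lambda>t. (cmod (?X t))\<^sup>2)"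
    proof (rule integrable_unit_leb_bounded)
      show "(\<lambda>t. (cmod (?X t))\<^sup>2) \<in> borel_measurable unit_leb"
        by (intro measurable_unit_leb_borel borel_measurable_continuous_onI continuous_intros)
      show "norm ((cmod (?X t))\<^sup>2) \<le> (\<Sum>n\<in>A. cmod (x n))\<^sup>2" for t
        using power_mono[OF bd[of t], of 2] by simp
    qed
    have "complex_of_real ((cmod (?X t))\<^sup>2) = (\<Sum>k\<in>{0}. 1 * echar k t) * (cnj (?X t) * ?X t)" for t
      unfolding complex_norm_square by (simp add: mult.commute)
    then have "(LINT t|unit_leb. complex_of_real ((cmod (?X t))\<^sup>2)) = (\<Sum>k\<in>{0}. 1 * cnj (corr_trunc x A k))"
      by (simp only: integral_trig_form[OF _ A] finite.intros)
    also have "\<dots> = corr_trunc x A 0"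
      by (simp add: corr_trunc_def mult.commute)
    also have "corr_trunc x A 0 = of_real (\<Sum>n\<in>A. (cmod (x n))\<^sup>2)"
      unfolding corr_trunc_def of_real_sum complex_norm_square by (intro sum.cong) auto
    finally have normX: "(LINT t|unit_leb. (cmod (?X t))\<^sup>2) = (\<Sum>n\<in>A. (cmod (x n))\<^sup>2)"
      unfolding integral_complex_of_real of_real_eq_iff .
    have "cmod (\<Sum>k\<in>K. \<gamma> k * cnj (corr_trunc x A k)) =
        cmod (LINT t|unit_leb. ?T t * (cnj (?X t) * ?X t))"
      by (simp only: integral_trig_form[OF K A])
    also have "\<dots> \<le> (LINT t|unit_leb. C * (cmod (?X t))\<^sup>2)"
    proof (rule Bochner_Integration.integral_norm_bound_integral)
      have le: "cmod (?T t * (cnj (?X t) * ?X t)) \<le> C * (cmod (?X t))\<^sup>2" for t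
        unfolding norm_mult complex_mod_cnj power2_eq_square by (intro mult_right_mono C) simp
      then show "\<And>t. cmod (?T t * (cnj (?X t) * ?X t)) \<le> C * (cmod (?X t))\<^sup>2" .
      show "integrable unit_leb (\<lambda>t. C * (cmod (?X t))\<^sup>2)" using iX by simp
      show "integrable unit_leb (\<lambda>t. ?T t * (cnj (?X t) * ?X t))"
      proof (rule Bochner_Integration.integrable_bound[OF \<open>integrable unit_leb (\<lambda>t. C * (cmod (?X t))\<^sup>2)\<close>])
        show "(\<lambda>t. ?T t * (cnj (?X t) * ?X t)) \<in> borel_measurable unit_leb"
          by (intro measurable_unit_leb_borel borel_measurable_continuous_onI continuous_intros)
        show "AE t in unit_leb. norm (?T t * (cnj (?X t) * ?X t)) \<le> norm (C * (cmod (?X t))\<^sup>2)"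
          by (intro AE_I2 order_trans[OF le]) (simp only: real_norm_def abs_ge_self)
      qed
    qed
    also have "\<dots> = C * (\<Sum>n\<in>A. (cmod (x n))\<^sup>2)"
      using iX by (simp add: normX)
    finally show ?thesis .
  qed
  have t1: "((\<lambda>A. cmod (\<Sum>k\<in>K. \<gamma> k * cnj (corr_trunc x A k))) \<longlongrightarrow>
      cmod (\<Sum>k\<in>K. \<gamma> k * cnj (corr x k))) (finite_subsets_at_top UNIV)"
    by (intro tendsto_intros corr_trunc_tendsto x)
  have t2: "((\<lambda>A. C * (\<Sum>n\<in>A. (cmod (x n))\<^sup>2)) \<longlongrightarrow> C * (\<Sum>\<^sub>\<infinity>n. (cmod (x n))\<^sup>2)) (finite_subsets_at_top UNIV)"
    using x unfolding square_summable_def by (intro tendsto_intros infsum_tendsto)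
  show ?thesis
    by (rule tendsto_le[OF finite_subsets_at_top_neq_bot t2 t1])
       (rule eventually_finite_subsets_at_top_weakI[OF fin])
qed

text \<open>
  Reduced to the upper bound: the symbol \<open>(A + B) / 2 - \<tau>\<close> has absolute value at most \<open>(B - A) / 2\<close>.
\<close>

lemma toeplitz_form_lower_bound:
  assumes K: "finite K" "0 \<in> K" and x: "square_summable x"
    and AB: "\<And>t. (\<Sum>k\<in>K. \<gamma> k * echar k t) = of_real (\<tau> t)" "\<And>t. A \<le> \<tau> t" "\<And>t. \<tau> t \<le> B"
  shows "A * (\<Sum>\<^sub>\<infinity>n. (cmod (x n))\<^sup>2) \<le> Re (\<Sum>k\<in>K. \<gamma> k * cnj (corr x k))"
proof -
  \<comment> \<open>coefficients of the symbol \<open>(A + B) / 2 - \<tau>\<close>\<close>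
  let ?\<delta> = "\<lambda>k. (if k = 0 then of_real ((A + B) / 2) else 0) - \<gamma> k"
  let ?S = "\<Sum>\<^sub>\<infinity>n. (cmod (x n))\<^sup>2"
  have \<delta>: "(\<Sum>k\<in>K. ?\<delta> k * F k) = of_real ((A + B) / 2) * F 0 - (\<Sum>k\<in>K. \<gamma> k * F k)" for F
  proof -
    have "(\<Sum>k\<in>K. ?\<delta> k * F k) = (\<Sum>k\<in>K. if k = 0 then of_real ((A + B) / 2) * F k else 0) - (\<Sum>k\<in>K. \<gamma> k * F k)"
      unfolding left_diff_distrib sum_subtractf by (auto intro!: sum.cong)
    then show ?thesis using K by simp
  qed
  have "cmod (\<Sum>k\<in>K. ?\<delta> k * echar k t) \<le> (B - A) / 2" for t
  proof -
    have "(\<Sum>k\<in>K. ?\<delta> k * echar k t) = of_real ((A + B) / 2 - \<tau> t)"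
      unfolding \<delta> AB(1) by simp
    also have "cmod \<dots> \<le> (B - A) / 2"
      unfolding norm_of_real using AB(2,3)[of t] by (simp add: abs_le_iff field_simps)
    finally show ?thesis .
  qed
  from toeplitz_form_bound[OF K(1) x this]
  have "cmod (of_real ((A + B) / 2) * cnj (corr x 0) - (\<Sum>k\<in>K. \<gamma> k * cnj (corr x k))) \<le> (B - A) / 2 * ?S"
    unfolding \<delta> .
  then have "Re (of_real ((A + B) / 2) * cnj (corr x 0) - (\<Sum>k\<in>K. \<gamma> k * cnj (corr x k))) \<le> (B - A) / 2 * ?S"
    using complex_Re_le_cmod order_trans by blast
  then have "(A + B) / 2 * ?S - Re (\<Sum>k\<in>K. \<gamma> k * cnj (corr x k)) \<le> (B - A) / 2 * ?S"
    by (simp add: corr_0[OF x])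
  then show ?thesis by (simp add: field_simps)
qed

lemma infsum_finite_support:
  fixes f :: "'i \<Rightarrow> complex"
  assumes "finite S" "\<And>n. n \<notin> S \<Longrightarrow> f n = 0"
  shows "infsum f UNIV = sum f S"
proof -
  have "infsum f UNIV = infsum f S" using assms(2) by (intro infsum_cong_neutral) auto
  then show ?thesis using assms(1) by simp
qed

lemma corr_finite_support:
  assumes "finite S" "\<And>n. n \<notin> S \<Longrightarrow> c n = 0"
  shows "corr c k = (\<Sum>n\<in>S. c n * cnj (c (n + k)))"
  unfolding corr_def using assms by (intro infsum_finite_support) auto

text \<open>
  Used with \<open>F\<close> an exponential, which gives partial sums of \<open>|p|\<^sup>2\<close>, and with \<open>F\<close> the conjugate autocorrelation of
  another sequence, which gives Toeplitz forms.
\<close>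

lemma sum_corr_finite_support:
  assumes S: "finite S" "\<And>n. n \<notin> S \<Longrightarrow> c n = 0" and K: "finite K"
  shows "(\<Sum>k\<in>K. corr c k * F k) = (\<Sum>b\<in>S. \<Sum>a\<in>{a \<in> S. a - b \<in> K}. c b * cnj (c a) * F (a - b))"
proof -
  have eq: "c b * cnj (c (b + k)) = (\<Sum>a\<in>S. if k = a - b then c b * cnj (c a) else 0)" for b k
  proof -
    have "(\<Sum>a\<in>S. if k = a - b then c b * cnj (c a) else 0) = (\<Sum>a\<in>S. if a = b + k then c b * cnj (c a) else 0)"
      by (intro sum.cong) auto
    then show ?thesis using S by simp
  qed
  have "(\<Sum>k\<in>K. corr c k * F k) = (\<Sum>k\<in>K. \<Sum>b\<in>S. \<Sum>a\<in>S. if k = a - b then c b * cnj (c a) * F k else 0)"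
  proof (intro sum.cong refl)
    fix k
    show "corr c k * F k = (\<Sum>b\<in>S. \<Sum>a\<in>S. if k = a - b then c b * cnj (c a) * F k else 0)"
    proof -
      have "corr c k = (\<Sum>b\<in>S. \<Sum>a\<in>S. if k = a - b then c b * cnj (c a) else 0)"
        by (subst corr_finite_support[OF S]) (auto intro!: sum.cong eq)
      then show ?thesis by (simp add: sum_distrib_right if_distrib[of "\<lambda>z. z * F k"] cong: if_cong)
    qed
  qed
  also have "\<dots> = (\<Sum>b\<in>S. \<Sum>a\<in>S. \<Sum>k\<in>K. if k = a - b then c b * cnj (c a) * F k else 0)"
    by (rule trans[OF sum.swap]) (rule sum.cong[OF refl sum.swap])
  also have "\<dots> = (\<Sum>b\<in>S. \<Sum>a\<in>{a \<in> S. a - b \<in> K}. c b * cnj (c a) * F (a - b))"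
    using K S(1) by (intro sum.cong[OF refl, where A = S]) (simp add: sum.inter_filter)
  finally show ?thesis .
qed

text \<open>
  This links the two sides of the frame identity on a single fiber: the squared norm of a convolution is the
  Toeplitz form whose symbol is the squared modulus of the multiplier.
\<close>

lemma convolution_norm_has_sum:
  assumes S: "finite S" "\<And>n. n \<notin> S \<Longrightarrow> c n = 0" and x: "square_summable x"
    and K: "finite K" "\<And>a b. a \<in> S \<Longrightarrow> b \<in> S \<Longrightarrow> a - b \<in> K"
  shows "((\<lambda>n. complex_of_real ((cmod (\<Sum>\<^sub>\<infinity>l. x l * cnj (c (l + n))))\<^sup>2)) has_sum
    (\<Sum>k\<in>K. corr c k * cnj (corr x k))) UNIV"
proof -
  have conv: "(\<Sum>\<^sub>\<infinity>l. x l * cnj (c (l + n))) = (\<Sum>a\<in>S. x (a - n) * cnj (c a))" for n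
  proof -
    have "(\<Sum>\<^sub>\<infinity>l. x l * cnj (c (l + n))) = (\<Sum>l\<in>(\<lambda>a. a - n) ` S. x l * cnj (c (l + n)))"
    proof (rule infsum_finite_support)
      fix l assume "l \<notin> (\<lambda>a. a - n) ` S"
      then have "l + n \<notin> S" by (metis add_diff_cancel_right' image_eqI)
      then show "x l * cnj (c (l + n)) = 0" using S by simp
    qed (use S in auto)
    then show ?thesis by (simp add: sum.reindex inj_on_def)
  qed
  have eq: "complex_of_real ((cmod (\<Sum>\<^sub>\<infinity>l. x l * cnj (c (l + n))))\<^sup>2) =
      (\<Sum>a\<in>S. \<Sum>b\<in>S. (cnj (c a) * c b) * (x (a - n) * cnj (x (b - n))))" for n
    unfolding conv complex_norm_square cnj_sum sum_product
    by (intro sum.cong refl) (simp add: mult_ac)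
  have "((\<lambda>n. \<Sum>a\<in>S. \<Sum>b\<in>S. (cnj (c a) * c b) * (x (a - n) * cnj (x (b - n)))) has_sum
      (\<Sum>a\<in>S. \<Sum>b\<in>S. (cnj (c a) * c b) * corr x (b - a))) UNIV"
    by (intro has_sum_finite_sum S has_sum_cmult_right corr_has_sum x)
  also have "(\<Sum>a\<in>S. \<Sum>b\<in>S. (cnj (c a) * c b) * corr x (b - a)) = (\<Sum>k\<in>K. corr c k * cnj (corr x k))"
  proof -
    have "(\<Sum>k\<in>K. corr c k * cnj (corr x k)) = (\<Sum>b\<in>S. \<Sum>a\<in>S. c b * cnj (c a) * corr x (b - a))"
    proof (subst sum_corr_finite_support[OF S K(1)])
      show "(\<Sum>b\<in>S. \<Sum>a\<in>{a \<in> S. a - b \<in> K}. c b * cnj (c a) * cnj (corr x (a - b))) =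
          (\<Sum>b\<in>S. \<Sum>a\<in>S. c b * cnj (c a) * corr x (b - a))"
        using K(2) by (intro sum.cong) (auto simp: cnj_corr[OF x])
    qed auto
    then show ?thesis by (subst sum.swap) (simp add: mult_ac)
  qed
  finally show "((\<lambda>n. complex_of_real ((cmod (\<Sum>\<^sub>\<infinity>l. x l * cnj (c (l + n))))\<^sup>2)) has_sum
      (\<Sum>k\<in>K. corr c k * cnj (corr x k))) UNIV" unfolding eq .
qed

section \<open>The fibers of the window\<close>

definition stage_len :: "nat \<Rightarrow> nat" where "stage_len i = 16 ^ i"

text \<open>
  The dilation factor grows so fast that every frequency of an earlier stage is smaller than the step of a
  later one.
\<close>

definition stage_step :: "nat \<Rightarrow> int" where "stage_step i = 32 ^ (i * i)"

text \<open>
  With \<open>N = 16\<^sup>i\<close> the amplitude is \<open>N\<^sup>-\<^sup>3\<^sup>/\<^sup>4\<close>. It has to be so small that \<open>N\<close> partial sums of size \<open>\<surd>N\<close>, weighted with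
  the square of the amplitude, stay bounded, and so large that \<open>N\<close> times the amplitude is unbounded.
\<close>

definition stage_amp :: "nat \<Rightarrow> real" where "stage_amp i = 1 / 8 ^ i"

text \<open>
  The shift by the length of the polynomial keeps the cross terms with the constant \<open>3\<close> apart from the
  autocorrelation of the polynomial itself.
\<close>

definition stage_pos :: "nat \<Rightarrow> nat \<Rightarrow> int" where
  "stage_pos i n = stage_step i * (int (stage_len i) + int n)"

definition stage_radius :: "nat \<Rightarrow> int" where
  "stage_radius i = 2 * stage_step i * int (stage_len i)"

definition window :: "nat \<Rightarrow> int \<Rightarrow> complex" where
  "window i m = (if m = 0 then 3 else
     (\<Sum>n\<in>{n. n < stage_len i \<and> m = stage_pos i n}. of_real (stage_amp i * rs_sign True (4 * i) n)))"

definition window_support :: "nat \<Rightarrow> int set" where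
  "window_support i = insert 0 (stage_pos i ` {..<stage_len i})"

lemma stage_step_pos: "0 < stage_step i" by (simp add: stage_step_def)

lemma stage_len_pos: "0 < stage_len i" by (simp add: stage_len_def)

lemma stage_pos_inj: "stage_pos i m = stage_pos i n \<longleftrightarrow> m = n"
  using stage_step_pos[of i] by (simp add: stage_pos_def)

lemma stage_pos_bounds:
  assumes "n < stage_len i"
  shows "0 < stage_pos i n" "stage_pos i n < stage_radius i"
proof -
  have "stage_step i * (int (stage_len i) + int n) < stage_step i * (2 * int (stage_len i))"
    using assms stage_step_pos[of i] by (intro mult_strict_left_mono) auto
  then show "stage_pos i n < stage_radius i" by (simp add: stage_pos_def stage_radius_def mult_ac)
  show "0 < stage_pos i n"
    using stage_len_pos[of i] stage_step_pos[of i] by (simp add: stage_pos_def)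
qed

lemma window_0: "window i 0 = 3" by (simp add: window_def)

lemma window_stage_pos:
  assumes "n < stage_len i"
  shows "window i (stage_pos i n) = of_real (stage_amp i * rs_sign True (4 * i) n)"
proof -
  have "{n'. n' < stage_len i \<and> stage_pos i n = stage_pos i n'} = {n}"
    using assms by (auto simp: stage_pos_inj)
  then show ?thesis using stage_pos_bounds[OF assms] by (simp add: window_def)
qed

lemma window_eq_0: "m \<notin> window_support i \<Longrightarrow> window i m = 0"
  unfolding window_def window_support_def by (auto intro!: sum.neutral)

lemma finite_window_support [simp]: "finite (window_support i)"
  by (simp add: window_support_def)

lemma window_support_bounds:
  assumes "m \<in> window_support i" shows "0 \<le> m" "m < stage_radius i"
  using assms stage_pos_bounds[of _ i] stage_step_pos[of i] stage_len_pos[of i]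
  by (auto simp: window_support_def stage_radius_def less_imp_le)

lemma sum_window_support:
  "(\<Sum>m\<in>{m \<in> window_support i. Q m}. window i m * F m) = (if Q 0 then 3 * F 0 else 0) +
    of_real (stage_amp i) * (\<Sum>n\<in>{n. n < stage_len i \<and> Q (stage_pos i n)}.
      of_real (rs_sign True (4 * i) n) * F (stage_pos i n))"
proof -
  have eq: "{m \<in> window_support i. Q m} =
      (if Q 0 then {0} else {}) \<union> stage_pos i ` {n. n < stage_len i \<and> Q (stage_pos i n)}"
    by (auto simp: window_support_def)
  have disj: "(if Q 0 then {0} else {}) \<inter> stage_pos i ` {n. n < stage_len i \<and> Q (stage_pos i n)} = {}"
    using stage_pos_bounds(1)[of _ i] by (auto split: if_splits) (metis less_irrefl)
  have "(\<Sum>m\<in>stage_pos i ` {n. n < stage_len i \<and> Q (stage_pos i n)}. window i m * F m) =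
      (\<Sum>n\<in>{n. n < stage_len i \<and> Q (stage_pos i n)}.
        of_real (stage_amp i) * (of_real (rs_sign True (4 * i) n) * F (stage_pos i n)))"
    by (subst sum.reindex) (auto simp: inj_on_def stage_pos_inj window_stage_pos intro!: sum.cong)
  then show ?thesis
    unfolding eq by (subst sum.union_disjoint[OF _ _ disj]) (auto simp: window_0 sum_distrib_left)
qed

lemma sqrt2_power: "sqrt 2 ^ (4 * i) = 4 ^ i"
  using power_mult[of "sqrt 2" 4 i] power_mult[of "sqrt 2" 2 2] by simp

lemma echar_stage_pos:
  "echar (- stage_pos i n) t =
     echar (- stage_step i * int (stage_len i)) t * echar (- stage_step i) t ^ n"
proof -
  have pow: "echar (m * int n) t = echar m t ^ n" for m
    by (induction n) (simp_all add: echar_add ring_distribs)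
  have "- stage_pos i n = - stage_step i * int (stage_len i) + - stage_step i * int n"
    by (simp add: stage_pos_def algebra_simps)
  then show ?thesis by (simp only: echar_add pow)
qed

definition window_poly :: "nat \<Rightarrow> (int \<Rightarrow> bool) \<Rightarrow> real \<Rightarrow> complex" where
  "window_poly i Q t = (\<Sum>m\<in>{m \<in> window_support i. Q m}. window i m * echar (- m) t)"

definition rs_part :: "nat \<Rightarrow> (int \<Rightarrow> bool) \<Rightarrow> real \<Rightarrow> complex" where
  "rs_part i Q t = of_real (stage_amp i) * (echar (- stage_step i * int (stage_len i)) t *
     rs_poly True (4 * i) (\<lambda>n. Q (stage_pos i n)) (echar (- stage_step i) t))"

lemma window_poly_eq: "window_poly i Q t = (if Q 0 then 3 else 0) + rs_part i Q t"
proof -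
  have len: "stage_len i = 2 ^ (4 * i)"
    by (simp add: stage_len_def power_mult)
  show ?thesis
    unfolding window_poly_def sum_window_support rs_part_def rs_poly_def len[symmetric]
    by (simp add: echar_stage_pos sum_distrib_left mult_ac)
qed

lemma norm_rs_part_full: "cmod (rs_part i (\<lambda>_. True) t) \<le> sqrt 2"
proof -
  have "cmod (rs_poly True (4 * i) (\<lambda>_. True) (echar (- stage_step i) t)) \<le> sqrt 2 * 4 ^ i"
    using norm_rs_poly_le[of "echar (- stage_step i) t" True "4 * i"] by (simp add: sqrt2_power)
  also have "\<dots> \<le> sqrt 2 * 8 ^ i" by (intro mult_left_mono power_mono) auto
  finally show ?thesis
    by (simp add: rs_part_def norm_mult norm_divide norm_power stage_amp_def divide_le_eq)
qed

lemma norm_rs_part_interval: "cmod (rs_part i (\<lambda>m. \<alpha> \<le> m \<and> m \<le> \<beta>) t) \<le> 8 / 2 ^ i"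
proof -
  have mono: "stage_pos i m \<le> stage_pos i n" if "m \<le> n" for m n
    using that stage_step_pos[of i] by (simp add: stage_pos_def)
  have "cmod (rs_poly True (4 * i) (\<lambda>n. stage_pos i n \<le> \<beta> \<and> \<not> stage_pos i n < \<alpha>) (echar (- stage_step i) t))
      \<le> 8 * sqrt 2 ^ (4 * i)"
    by (rule norm_rs_poly_interval_le) (use mono order_trans le_less_trans in \<open>fastforce+\<close>)
  then have "cmod (rs_poly True (4 * i) (\<lambda>n. \<alpha> \<le> stage_pos i n \<and> stage_pos i n \<le> \<beta>) (echar (- stage_step i) t))
      \<le> 8 * 4 ^ i"
    by (simp add: sqrt2_power not_less conj_commute)
  then have "cmod (rs_part i (\<lambda>m. \<alpha> \<le> m \<and> m \<le> \<beta>) t) \<le> 8 * 4 ^ i / 8 ^ i"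
    by (simp add: rs_part_def norm_mult norm_divide norm_power stage_amp_def divide_right_mono)
  also have "\<dots> = 8 / 2 ^ i"
    using power_mult_distrib[of "4 :: real" 2 i] by (simp add: field_simps)
  finally show ?thesis .
qed

lemma window_autocorr_partial_sum:
  "(\<Sum>k\<in>{\<alpha>..\<beta>}. corr (window i) k * echar k t) =
     (\<Sum>b\<in>window_support i. window i b * echar (- b) t *
        cnj (window_poly i (\<lambda>m. \<alpha> + b \<le> m \<and> m \<le> \<beta> + b) t))"
proof -
  have "(\<Sum>k\<in>{\<alpha>..\<beta>}. corr (window i) k * echar k t) =
    (\<Sum>b\<in>window_support i. \<Sum>a\<in>{a \<in> window_support i. a - b \<in> {\<alpha>..\<beta>}}.
      window i b * cnj (window i a) * echar (a - b) t)"
    by (rule sum_corr_finite_support) (auto intro: window_eq_0)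
  also have "\<dots> = (\<Sum>b\<in>window_support i. window i b * echar (- b) t *
        cnj (window_poly i (\<lambda>m. \<alpha> + b \<le> m \<and> m \<le> \<beta> + b) t))"
  proof (rule sum.cong[OF refl])
    fix b
    have set: "{a \<in> window_support i. a - b \<in> {\<alpha>..\<beta>}} = {m \<in> window_support i. \<alpha> + b \<le> m \<and> m \<le> \<beta> + b}"
      by auto
    have "echar (a - b) t = echar a t * echar (- b) t" for a
      using echar_add[of a "- b" t] by simp
    then show "(\<Sum>a\<in>{a \<in> window_support i. a - b \<in> {\<alpha>..\<beta>}}. window i b * cnj (window i a) * echar (a - b) t) =
      window i b * echar (- b) t * cnj (window_poly i (\<lambda>m. \<alpha> + b \<le> m \<and> m \<le> \<beta> + b) t)"
      unfolding set window_poly_def by (simp add: sum_distrib_left mult_ac)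
  qed
  finally show ?thesis .
qed

text \<open>
  A partial sum of \<open>|p|\<^sup>2\<close> is the sum over \<open>b\<close> of the \<open>b\<close>-th term of \<open>p\<close> times a conjugated partial sum of \<open>p\<close>. The
  constant parts of these partial sums reassemble to a partial sum of \<open>p\<close> itself. Against the Rudin-Shapiro
  parts a crude term by term estimate suffices, since \<open>16\<^sup>i \<sqdot> 8\<^sup>-\<^sup>i \<sqdot> 8 \<sqdot> 2\<^sup>-\<^sup>i = 8\<close>.
\<close>

lemma norm_window_autocorr_partial_sum:
  "cmod (\<Sum>k\<in>{\<alpha>..\<beta>}. corr (window i) k * echar k t) \<le> 65"
proof -
  define q where "q b = rs_part i (\<lambda>m. \<alpha> + b \<le> m \<and> m \<le> \<beta> + b) t" for b
  \<comment> \<open>whether the index window shifted by \<open>b\<close> contains the constant term of the polynomial\<close>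
  define hit where "hit b \<longleftrightarrow> \<alpha> + b \<le> 0 \<and> 0 \<le> \<beta> + b" for b
  have q: "cmod (q b) \<le> 8 / 2 ^ i" for b
    unfolding q_def by (rule norm_rs_part_interval)
  then have q8: "cmod (q b) \<le> 8" for b
    by (rule order_trans) (simp add: field_simps)
  have poly: "window_poly i (\<lambda>m. \<alpha> + b \<le> m \<and> m \<le> \<beta> + b) t = (if hit b then 3 else 0) + q b" for b
    unfolding window_poly_eq q_def hit_def by simp
  let ?w = "\<lambda>n. of_real (rs_sign True (4 * i) n) :: complex"
  let ?e = "\<lambda>n. echar (- stage_pos i n) t"
  have "(\<Sum>k\<in>{\<alpha>..\<beta>}. corr (window i) k * echar k t) =
      (\<Sum>b\<in>window_support i. window i b * (echar (- b) t * cnj (if hit b then 3 else 0))) +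
      (\<Sum>b\<in>window_support i. window i b * (echar (- b) t * cnj (q b)))"
    unfolding window_autocorr_partial_sum poly by (simp add: sum.distrib[symmetric] algebra_simps)
  also have "(\<Sum>b\<in>window_support i. window i b * (echar (- b) t * cnj (if hit b then 3 else 0))) =
      3 * window_poly i (\<lambda>m. - \<beta> \<le> m \<and> m \<le> - \<alpha>) t"
    unfolding window_poly_def hit_def sum_distrib_left
    by (subst sum.inter_filter) (auto intro!: sum.cong)
  also have "(\<Sum>b\<in>window_support i. window i b * (echar (- b) t * cnj (q b))) =
      3 * cnj (q 0) + of_real (stage_amp i) * (\<Sum>n<stage_len i. ?w n * (?e n * cnj (q (stage_pos i n))))"
    using sum_window_support[of i "\<lambda>b. echar (- b) t * cnj (q b)" "\<lambda>_. True"]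
    by (simp add: lessThan_def)
  finally have eq: "(\<Sum>k\<in>{\<alpha>..\<beta>}. corr (window i) k * echar k t) =
      3 * window_poly i (\<lambda>m. - \<beta> \<le> m \<and> m \<le> - \<alpha>) t + (3 * cnj (q 0) +
      of_real (stage_amp i) * (\<Sum>n<stage_len i. ?w n * (?e n * cnj (q (stage_pos i n)))))" .
  have "cmod (window_poly i (\<lambda>m. - \<beta> \<le> m \<and> m \<le> - \<alpha>) t) \<le> 3 + 8 / 2 ^ i"
    unfolding window_poly_eq by (rule norm_triangle_le) (use norm_rs_part_interval[of i "- \<beta>" "- \<alpha>" t] in auto)
  also have "(8::real) / 2 ^ i \<le> 8" by (simp add: field_simps)
  finally have 1: "cmod (3 * window_poly i (\<lambda>m. - \<beta> \<le> m \<and> m \<le> - \<alpha>) t) \<le> 33"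
    by (simp add: norm_mult)
  have 2: "cmod (3 * cnj (q 0)) \<le> 24" using q8[of 0] by (simp add: norm_mult)
  have "cmod (\<Sum>n<stage_len i. ?w n * (?e n * cnj (q (stage_pos i n)))) \<le> (\<Sum>n<stage_len i. 8 / 2 ^ i)"
    by (rule sum_norm_le) (use q in \<open>simp add: norm_mult\<close>)
  also have "\<dots> = 8 * 8 ^ i"
    using power_mult_distrib[of "8 :: real" 2 i] by (simp add: stage_len_def field_simps)
  finally have 3: "cmod (of_real (stage_amp i) * (\<Sum>n<stage_len i. ?w n * (?e n * cnj (q (stage_pos i n))))) \<le> 8"
    by (simp add: norm_mult norm_divide norm_power stage_amp_def divide_le_eq)
  show ?thesis
    unfolding eq by (rule norm_triangle_le, rule order_trans[OF add_mono[OF 1 norm_triangle_mono[OF 2 3]]]) simp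
qed

lemma window_autocorr_full_sum:
  "(\<Sum>k\<in>{- stage_radius i..stage_radius i}. corr (window i) k * echar k t) =
     of_real ((cmod (window_poly i (\<lambda>_. True) t))\<^sup>2)"
proof -
  have "window_poly i (\<lambda>m. - stage_radius i + b \<le> m \<and> m \<le> stage_radius i + b) t = window_poly i (\<lambda>_. True) t"
    if "b \<in> window_support i" for b
    unfolding window_poly_def using window_support_bounds that
    by (intro sum.cong) (fastforce intro: less_imp_le)+
  then show ?thesis
    unfolding window_autocorr_partial_sum complex_norm_square
    by (simp add: window_poly_def sum_distrib_right)
qed

lemma window_poly_square_bounds:
  "1 \<le> (cmod (window_poly i (\<lambda>_. True) t))\<^sup>2" "(cmod (window_poly i (\<lambda>_. True) t))\<^sup>2 \<le> 25"
proof -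
  have s: "sqrt 2 \<le> 2" by (rule real_le_lsqrt) auto
  have "1 \<le> cmod (window_poly i (\<lambda>_. True) t)"
    using norm_rs_part_full[of i t] s norm_triangle_ineq4[of "3 + rs_part i (\<lambda>_. True) t" "rs_part i (\<lambda>_. True) t"]
    by (simp add: window_poly_eq)
  from power_mono[OF this, of 2] show "1 \<le> (cmod (window_poly i (\<lambda>_. True) t))\<^sup>2" by simp
  have "cmod (window_poly i (\<lambda>_. True) t) \<le> 5"
    using norm_rs_part_full[of i t] s norm_triangle_ineq[of 3 "rs_part i (\<lambda>_. True) t"]
    by (simp add: window_poly_eq)
  from power_mono[OF this, of 2] show "(cmod (window_poly i (\<lambda>_. True) t))\<^sup>2 \<le> 25" by simp
qed

section \<open>Functions given by their fibers\<close>

definition window_form :: "nat \<Rightarrow> int \<Rightarrow> int \<Rightarrow> (int \<Rightarrow> complex) \<Rightarrow> complex" where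
  "window_form i \<alpha> \<beta> x = (\<Sum>k\<in>{\<alpha>..\<beta>}. corr (window i) k * cnj (corr x k))"

definition window_energy :: "nat \<Rightarrow> (int \<Rightarrow> complex) \<Rightarrow> real" where
  "window_energy i x = Re (window_form i (- stage_radius i) (stage_radius i) x)"

lemma norm_window_form_le:
  assumes "square_summable x"
  shows "cmod (window_form i \<alpha> \<beta> x) \<le> 65 * (\<Sum>\<^sub>\<infinity>n. (cmod (x n))\<^sup>2)"
  unfolding window_form_def
  by (rule toeplitz_form_bound) (auto intro: assms norm_window_autocorr_partial_sum)

lemma window_energy_bounds:
  assumes "square_summable x"
  shows "(\<Sum>\<^sub>\<infinity>n. (cmod (x n))\<^sup>2) \<le> window_energy i x"
    and "window_energy i x \<le> 25 * (\<Sum>\<^sub>\<infinity>n. (cmod (x n))\<^sup>2)"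
proof -
  have R: "0 < stage_radius i"
    using stage_step_pos[of i] stage_len_pos[of i] by (simp add: stage_radius_def)
  have "1 * (\<Sum>\<^sub>\<infinity>n. (cmod (x n))\<^sup>2) \<le> window_energy i x"
    unfolding window_energy_def window_form_def
    by (rule toeplitz_form_lower_bound[OF _ _ assms window_autocorr_full_sum])
       (use R window_poly_square_bounds in auto)
  then show "(\<Sum>\<^sub>\<infinity>n. (cmod (x n))\<^sup>2) \<le> window_energy i x" by simp
  have "cmod (window_form i (- stage_radius i) (stage_radius i) x) \<le> 25 * (\<Sum>\<^sub>\<infinity>n. (cmod (x n))\<^sup>2)"
    unfolding window_form_def
  proof (rule toeplitz_form_bound[OF _ assms])
    show "cmod (\<Sum>k\<in>{- stage_radius i..stage_radius i}. corr (window i) k * echar k t) \<le> 25" for t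
      unfolding window_autocorr_full_sum norm_of_real using window_poly_square_bounds(2)[of i t] by simp
  qed simp
  then show "window_energy i x \<le> 25 * (\<Sum>\<^sub>\<infinity>n. (cmod (x n))\<^sup>2)"
    unfolding window_energy_def using complex_Re_le_cmod order_trans by blast
qed

lemma window_convolution_has_sum:
  assumes "square_summable x"
  shows "((\<lambda>n. complex_of_real ((cmod (\<Sum>\<^sub>\<infinity>l. x l * cnj (window i (l + n))))\<^sup>2)) has_sum
    window_form i (- stage_radius i) (stage_radius i) x) UNIV"
  unfolding window_form_def
proof (rule convolution_norm_has_sum[OF finite_window_support window_eq_0 assms])
  fix a b assume "a \<in> window_support i" "b \<in> window_support i"
  then show "a - b \<in> {- stage_radius i..stage_radius i}"
    using window_support_bounds[of a i] window_support_bounds[of b i] by auto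
qed auto

lemma window_energy_has_sum:
  assumes "square_summable x"
  shows "((\<lambda>n. (cmod (\<Sum>\<^sub>\<infinity>l. x l * cnj (window i (l + n))))\<^sup>2) has_sum window_energy i x) UNIV"
  using has_sum_Re[OF window_convolution_has_sum[OF assms, of i]] by (simp add: window_energy_def)

lemma window_form_eq_energy:
  assumes "square_summable x"
  shows "window_form i (- stage_radius i) (stage_radius i) x = of_real (window_energy i x)"
  using window_convolution_has_sum[OF assms, of i] has_sum_of_real[OF window_energy_has_sum[OF assms, of i]]
  by (rule has_sum_unique)

lemma corr_window: "corr (window i) k = (\<Sum>n\<in>window_support i. window i n * cnj (window i (n + k)))"
  by (rule corr_finite_support) (auto intro: window_eq_0)

lemma corr_window_eq_0:
  assumes "stage_radius i \<le> \<bar>k\<bar>"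
  shows "corr (window i) k = 0"
proof -
  have "window i n * cnj (window i (n + k)) = 0" if "n \<in> window_support i" for n
  proof -
    have "n + k \<notin> window_support i"
      using window_support_bounds[OF that] window_support_bounds[of "n + k" i] assms by auto
    then show ?thesis by (simp add: window_eq_0)
  qed
  then show ?thesis unfolding corr_window by (intro sum.neutral) blast
qed

lemma window_form_wide:
  assumes "\<alpha> \<le> - stage_radius i" "stage_radius i \<le> \<beta>"
  shows "window_form i \<alpha> \<beta> x = window_form i (- stage_radius i) (stage_radius i) x"
  unfolding window_form_def
  using assms by (intro sum.mono_neutral_right) (auto simp: corr_window_eq_0)

text \<open>
  The stages occupy the intervals \<open>(1/(j+1), 1/j]\<close>, whose lengths decrease only polynomially in \<open>j\<close>.
\<close>

definition stage_of :: "real \<Rightarrow> nat" where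
  "stage_of t = nat \<lfloor>1 / t\<rfloor>"

text \<open>
  The sign of the floor makes \<open>c j n\<close> the value at \<open>t - n\<close>, in accordance with the translations in the frame.
\<close>

definition fiber_fun :: "(nat \<Rightarrow> int \<Rightarrow> complex) \<Rightarrow> real \<Rightarrow> complex" where
  "fiber_fun c x = c (stage_of (frac x)) (- \<lfloor>x\<rfloor>)"

definition fiber :: "(real \<Rightarrow> complex) \<Rightarrow> real \<Rightarrow> int \<Rightarrow> complex" where
  "fiber f t n = f (t - of_int n)"

lemma fiber_fiber_fun:
  assumes "t \<in> {0..<1}"
  shows "fiber (fiber_fun c) t = c (stage_of t)"
proof
  fix n
  have "\<lfloor>t - of_int n\<rfloor> = - n" using assms by (simp add: floor_eq_iff)
  then show "fiber (fiber_fun c) t n = c (stage_of t) n"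
    by (simp add: fiber_def fiber_fun_def frac_def)
qed

lemma measurable_stage_of [measurable]: "stage_of \<in> borel \<rightarrow>\<^sub>M count_space UNIV"
  unfolding stage_of_def by measurable

lemma measurable_frac: "(frac :: real \<Rightarrow> real) \<in> borel_measurable borel"
  unfolding frac_def by measurable

lemma borel_measurable_fiber_fun: "fiber_fun c \<in> borel_measurable borel"
proof -
  have J: "(\<lambda>x. stage_of (frac x)) \<in> borel \<rightarrow>\<^sub>M count_space UNIV"
    using measurable_compose[OF measurable_frac measurable_stage_of] .
  have "(\<lambda>x. (\<lambda>j x. c j (- \<lfloor>x\<rfloor>)) (stage_of (frac x)) x) \<in> borel_measurable borel"
    by (rule measurable_compose_countable[OF _ J]) measurable
  then show ?thesis unfolding fiber_fun_def .
qed

lemma lebesgue_measurable_fiber_fun: "fiber_fun c \<in> borel_measurable lebesgue"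
  using borel_measurable_fiber_fun by (intro measurable_completion) simp

lemma fiber_fun_L2:
  assumes fin: "\<And>j. finite (S j)" "\<And>j n. n \<notin> S j \<Longrightarrow> c j n = 0"
    and bd: "\<And>j. (\<Sum>n\<in>S j. (cmod (c j n))\<^sup>2) \<le> B"
  shows "fiber_fun c \<in> L2"
proof -
  note m [measurable] = lebesgue_measurable_fiber_fun[of c]
  have fold: "(\<integral>\<^sup>+n. ennreal ((cmod (fiber_fun c (t - of_int n)))\<^sup>2) \<partial>int_count) \<le> ennreal B"
    if "t \<in> {0..<1}" for t
  proof -
    have "(\<integral>\<^sup>+n. ennreal ((cmod (fiber_fun c (t - of_int n)))\<^sup>2) \<partial>int_count) =
        (\<integral>\<^sup>+n. ennreal ((cmod (c (stage_of t) n))\<^sup>2) \<partial>int_count)"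
      using fiber_fiber_fun[OF that, of c] by (simp add: fiber_def fun_eq_iff)
    also have "\<dots> = (\<Sum>n\<in>S (stage_of t). ennreal ((cmod (c (stage_of t) n))\<^sup>2))"
      using fin by (intro nn_integral_count_space') auto
    also have "\<dots> = ennreal (\<Sum>n\<in>S (stage_of t). (cmod (c (stage_of t) n))\<^sup>2)"
      by (rule sum_ennreal) simp
    also have "\<dots> \<le> ennreal B" by (intro ennreal_leI bd)
    finally show ?thesis .
  qed
  have "(\<integral>\<^sup>+x. ennreal ((cmod (fiber_fun c x))\<^sup>2) \<partial>lebesgue) =
      (\<integral>\<^sup>+t. (\<integral>\<^sup>+n. ennreal ((cmod (fiber_fun c (t - of_int n)))\<^sup>2) \<partial>int_count) \<partial>unit_leb)"
    by (rule nn_integral_fold) measurable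
  also have "\<dots> \<le> (\<integral>\<^sup>+t. ennreal B \<partial>unit_leb)"
    by (intro nn_integral_mono) (use fold in simp)
  also have "\<dots> < \<infinity>"
    using finite_measure.emeasure_finite[OF finite_measure_unit_leb, of "space unit_leb"]
    by (simp add: ennreal_mult_less_top less_top)
  finally show ?thesis
    unfolding L2_def using m by (auto simp: integrable_iff_bounded)
qed

definition gabor_window :: "real \<Rightarrow> complex" where
  "gabor_window = fiber_fun window"

lemma sum_window_square_le: "(\<Sum>n\<in>window_support i. (cmod (window i n))\<^sup>2) \<le> 65"
proof -
  have "of_real (\<Sum>n\<in>window_support i. (cmod (window i n))\<^sup>2) = corr (window i) 0"
    unfolding corr_window of_real_sum complex_norm_square
    by simp
  then have "complex_of_real (\<Sum>n\<in>window_support i. (cmod (window i n))\<^sup>2) =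
      (\<Sum>k\<in>{0..0}. corr (window i) k * echar k 0)" by simp
  then have "\<bar>\<Sum>n\<in>window_support i. (cmod (window i n))\<^sup>2\<bar> \<le> 65"
    using norm_window_autocorr_partial_sum[where \<alpha> = 0 and \<beta> = 0 and i = i and t = 0] by (metis norm_of_real)
  then show ?thesis by linarith
qed

lemma norm_corr_window_le: "cmod (corr (window i) k) \<le> 65"
  using norm_window_autocorr_partial_sum[where \<alpha> = k and \<beta> = k and i = i and t = 0] by (simp add: norm_mult)

lemma gabor_window_L2: "gabor_window \<in> L2"
  unfolding gabor_window_def
  by (rule fiber_fun_L2[OF finite_window_support window_eq_0 sum_window_square_le])

lemma WH_G_gabor_window: "WH_G gabor_window k x = corr (window (stage_of (frac x))) k"
proof -
  have t: "frac x \<in> {0..<1}" by (simp add: frac_lt_1)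
  have val: "gabor_window (x - of_int n - of_int l) = window (stage_of (frac x)) (- \<lfloor>x\<rfloor> + n + l)" for n l
  proof -
    have "gabor_window (x - of_int n - of_int l) = fiber gabor_window (frac x) (- \<lfloor>x\<rfloor> + n + l)"
      by (simp add: fiber_def frac_def algebra_simps)
    then show ?thesis using fiber_fiber_fun[OF t] by (simp add: gabor_window_def)
  qed
  let ?w = "window (stage_of (frac x))"
  have "WH_G gabor_window k x = (\<Sum>\<^sub>\<infinity>n. ?w (n + - \<lfloor>x\<rfloor>) * cnj (?w ((n + - \<lfloor>x\<rfloor>) + k)))"
    using val[of _ 0] val[of _ k] unfolding WH_G_def by (simp add: algebra_simps)
  also have "\<dots> = corr ?w k"
    unfolding corr_def
    by (rule infsum_reindex_bij_betw[OF bij_betw_int_add, of "\<lambda>n. ?w n * cnj (?w (n + k))"])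
  finally show ?thesis .
qed

lemma lebesgue_measurable_stage_fun: "(\<lambda>x. F (stage_of (frac x)) :: complex) \<in> borel_measurable lebesgue"
proof -
  have "(\<lambda>x. F (stage_of (frac x))) \<in> borel_measurable borel"
    by (rule measurable_compose[OF measurable_compose[OF measurable_frac measurable_stage_of]]) simp
  then show ?thesis by (intro measurable_completion) simp
qed

lemma infsum_complex_of_real: "(\<Sum>\<^sub>\<infinity>n\<in>A. complex_of_real (f n)) = of_real (\<Sum>\<^sub>\<infinity>n\<in>A. f n)"
  and summable_complex_of_real_iff: "(\<lambda>n. complex_of_real (f n)) summable_on A \<longleftrightarrow> f summable_on A"
proof -
  show iff: "(\<lambda>n. complex_of_real (f n)) summable_on A \<longleftrightarrow> f summable_on A"
    using summable_on_Re[of "\<lambda>n. complex_of_real (f n)" A] summable_on_of_real[of f A] by auto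
  show "(\<Sum>\<^sub>\<infinity>n\<in>A. complex_of_real (f n)) = of_real (\<Sum>\<^sub>\<infinity>n\<in>A. f n)"
  proof (cases "f summable_on A")
    case True
    then show ?thesis by (intro infsumI has_sum_of_real has_sum_infsum)
  qed (simp add: infsum_not_exists iff)
qed

lemma
  assumes "f \<in> L2"
  shows L2_fiber_square_summable: "AE t in unit_leb. square_summable (fiber f t)"
    and L2_fiber_norm_integrable: "integrable unit_leb (\<lambda>t. \<Sum>\<^sub>\<infinity>n. (cmod (fiber f t n))\<^sup>2)"
    and L2_norm_fiber: "(L2_norm f)\<^sup>2 = (LINT t|unit_leb. (\<Sum>\<^sub>\<infinity>n. (cmod (fiber f t n))\<^sup>2))"
proof -
  have int: "integrable lebesgue (\<lambda>x. complex_of_real ((cmod (f x))\<^sup>2))"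
    using assms unfolding L2_def by (intro integrable_of_real) auto
  show "AE t in unit_leb. square_summable (fiber f t)"
    using integral_fold(1)[OF int] unfolding summable_complex_of_real_iff square_summable_def fiber_def .
  have cint: "integrable unit_leb (\<lambda>t. complex_of_real (\<Sum>\<^sub>\<infinity>n. (cmod (fiber f t n))\<^sup>2))"
    using integral_fold(2)[OF int] unfolding infsum_complex_of_real fiber_def .
  then show "integrable unit_leb (\<lambda>t. \<Sum>\<^sub>\<infinity>n. (cmod (fiber f t n))\<^sup>2)"
    using integrable_Re[OF cint] by simp
  have "(LINT x|lebesgue. (cmod (f x))\<^sup>2) = (LINT t|unit_leb. (\<Sum>\<^sub>\<infinity>n. (cmod (fiber f t n))\<^sup>2))"
    using integral_fold(3)[OF int]
    unfolding infsum_complex_of_real fiber_def integral_complex_of_real of_real_eq_iff .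
  then show "(L2_norm f)\<^sup>2 = (LINT t|unit_leb. (\<Sum>\<^sub>\<infinity>n. (cmod (fiber f t n))\<^sup>2))"
    unfolding L2_norm_def by (subst real_sqrt_pow2[OF Bochner_Integration.integral_nonneg]) simp_all
qed

lemma translate_L2:
  assumes "f \<in> L2" shows "translate c f \<in> L2"
proof -
  have m: "(\<lambda>x. f (x - c)) \<in> borel_measurable lebesgue"
    by (rule measurable_compose[OF measurable_shift_lebesgue]) (use assms in \<open>simp add: L2_def\<close>)
  have "integrable lebesgue (\<lambda>x. (cmod (f (- c + 1 * x)))\<^sup>2)"
    using assms lebesgue_integrable_real_affine_iff[of 1 "\<lambda>x. (cmod (f x))\<^sup>2" "- c"] by (simp add: L2_def)
  with m show ?thesis by (simp add: L2_def translate_def[abs_def])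
qed

lemma L2_mult_integrable:
  assumes "f \<in> L2" "g \<in> L2"
  shows "integrable lebesgue (\<lambda>x. f x * cnj (g x))"
proof (rule Bochner_Integration.integrable_bound)
  show "integrable lebesgue (\<lambda>x. (cmod (f x))\<^sup>2 + (cmod (g x))\<^sup>2)"
    using assms by (simp add: L2_def)
  have [measurable]: "f \<in> borel_measurable lebesgue" "g \<in> borel_measurable lebesgue"
    using assms by (auto simp: L2_def)
  have [measurable]: "(\<lambda>x. cnj (g x)) \<in> borel_measurable lebesgue"
    by (rule measurable_compose[of g _ borel cnj]) (auto intro!: borel_measurable_continuous_onI continuous_intros)
  show "(\<lambda>x. f x * cnj (g x)) \<in> borel_measurable lebesgue" by measurable
  show "AE x in lebesgue. norm (f x * cnj (g x)) \<le> norm ((cmod (f x))\<^sup>2 + (cmod (g x))\<^sup>2)"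
  proof (rule AE_I2)
    fix x
    have "2 * (cmod (f x) * cmod (g x)) \<le> (cmod (f x))\<^sup>2 + (cmod (g x))\<^sup>2"
      using sum_squares_bound[of "cmod (f x)" "cmod (g x)"] by simp
    moreover have "0 \<le> cmod (f x) * cmod (g x)" by simp
    ultimately show "norm (f x * cnj (g x)) \<le> norm ((cmod (f x))\<^sup>2 + (cmod (g x))\<^sup>2)"
      unfolding norm_mult complex_mod_cnj real_norm_def by linarith
  qed
qed

lemma integrable_bounded_mult:
  fixes u v :: "real \<Rightarrow> complex"
  assumes "integrable lebesgue u" "v \<in> borel_measurable lebesgue" "\<And>x. cmod (v x) \<le> B"
  shows "integrable lebesgue (\<lambda>x. u x * v x)"
proof (rule Bochner_Integration.integrable_bound)
  show "integrable lebesgue (\<lambda>x. B * cmod (u x))" using assms by simp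
  have [measurable]: "u \<in> borel_measurable lebesgue" "v \<in> borel_measurable lebesgue" using assms by auto
  show "(\<lambda>x. u x * v x) \<in> borel_measurable lebesgue" by measurable
  have "cmod (u x) * cmod (v x) \<le> B * cmod (u x)" for x
    using mult_left_mono[OF assms(3)[of x], of "cmod (u x)"] by (simp add: mult.commute)
  then show "AE x in lebesgue. norm (u x * v x) \<le> norm (B * cmod (u x))"
    by (intro AE_I2) (metis abs_ge_self norm_mult order_trans real_norm_def)
qed

text \<open>
  Since \<open>G\<^sub>k\<close> has period \<open>1\<close> and depends on the stage only, folding the integral turns each term of the identity
  into the product of an autocorrelation of the window and one of the fiber of \<open>f\<close>. A partial sum of the
  identity is thus an integral of Toeplitz forms.
\<close>

lemma
  assumes f: "f \<in> L2"
  shows identity_term_integrable: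
      "integrable unit_leb (\<lambda>t. corr (window (stage_of t)) k * cnj (corr (fiber f t) k))"
    and identity_term_eq: "WH_identity_term gabor_window f k =
      (LINT t|unit_leb. corr (window (stage_of t)) k * cnj (corr (fiber f t) k))"
proof -
  let ?u = "\<lambda>x. (translate (of_int k) f x * cnj (f x)) * WH_G gabor_window k x"
  have int: "integrable lebesgue ?u"
  proof (rule integrable_bounded_mult[where B = 65])
    show "integrable lebesgue (\<lambda>x. translate (of_int k) f x * cnj (f x))"
      by (intro L2_mult_integrable translate_L2 f)
  qed (auto simp: WH_G_gabor_window norm_corr_window_le
      intro: lebesgue_measurable_stage_fun[of "\<lambda>j. corr (window j) k"])
  have fold: "(\<Sum>\<^sub>\<infinity>n. ?u (t - of_int n)) = corr (window (stage_of t)) k * cnj (corr (fiber f t) k)"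
    if t: "t \<in> {0..<1}" for t
  proof -
    have frac: "frac (t - of_int n) = t" for n
      using t by (simp add: frac_unique_iff)
    have "(\<Sum>\<^sub>\<infinity>n. ?u (t - of_int n)) =
        (\<Sum>\<^sub>\<infinity>n. corr (window (stage_of t)) k * cnj (fiber f t n * cnj (fiber f t (n + k))))"
      unfolding WH_G_gabor_window frac by (intro infsum_cong) (simp add: fiber_def translate_def algebra_simps)
    then show ?thesis by (simp only: infsum_cmult_right' infsum_cnj corr_def)
  qed
  show "integrable unit_leb (\<lambda>t. corr (window (stage_of t)) k * cnj (corr (fiber f t) k))"
    using integral_fold(2)[OF int] by (subst (asm) Bochner_Integration.integrable_cong[OF refl fold]) auto
  have "WH_identity_term gabor_window f k = (LINT x|lebesgue. ?u x)"
    by (simp add: WH_identity_term_def translate_def mult.commute)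
  also have "\<dots> = (LINT t|unit_leb. corr (window (stage_of t)) k * cnj (corr (fiber f t) k))"
    unfolding integral_fold(3)[OF int]
    by (intro Bochner_Integration.integral_cong refl fold) simp
  finally show "WH_identity_term gabor_window f k =
      (LINT t|unit_leb. corr (window (stage_of t)) k * cnj (corr (fiber f t) k))" .
qed

section \<open>The frame property and convergence of the identity\<close>

text \<open>
  The periodisation of \<open>f\<close> times the conjugate of the \<open>n\<close>-th translate of the window; its Fourier coefficients
  are the frame coefficients.
\<close>

definition fiber_conv :: "(real \<Rightarrow> complex) \<Rightarrow> int \<Rightarrow> real \<Rightarrow> complex" where
  "fiber_conv f n t = (\<Sum>\<^sub>\<infinity>l. fiber f t l * cnj (window (stage_of t) (l + n)))"

definition fiber_energy :: "(real \<Rightarrow> complex) \<Rightarrow> real \<Rightarrow> real" where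
  "fiber_energy f t = window_energy (stage_of t) (fiber f t)"

lemma WH_system_gabor_window: "WH_system gabor_window (m, n) x = echar m x * translate (of_int n) gabor_window x"
  by (simp add: WH_system_def modulate_def echar_def cis_conv_exp mult_ac)

lemma
  assumes f: "f \<in> L2"
  shows fiber_conv_integrable: "integrable unit_leb (fiber_conv f n)"
    and WH_coefficient: "L2_inner f (WH_system gabor_window (m, n)) = fourier_coeff (fiber_conv f n) m"
proof -
  have cont: "continuous_on UNIV (echar k)" for k by (intro continuous_intros)
  have me: "echar k \<in> borel_measurable lebesgue" for k
    using borel_measurable_continuous_onI[OF cont] by (intro measurable_completion) simp
  let ?u = "\<lambda>k x. (f x * cnj (translate (of_int n) gabor_window x)) * echar k x"
  have int: "integrable lebesgue (?u k)" for k
    by (rule integrable_bounded_mult[where B = 1])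
       (auto intro: L2_mult_integrable f translate_L2 gabor_window_L2 me)
  have fold: "(\<Sum>\<^sub>\<infinity>l. ?u k (t - of_int l)) = fiber_conv f n t * echar k t" if t: "t \<in> {0..<1}" for t k
  proof -
    have "translate (of_int n) gabor_window (t - of_int l) = window (stage_of t) (l + n)" for l
      using fiber_fiber_fun[OF t, of window]
      by (simp add: fun_eq_iff fiber_def translate_def gabor_window_def diff_diff_eq flip: of_int_add)
    then show ?thesis
      unfolding fiber_conv_def by (simp add: fiber_def echar_periodic infsum_cmult_left')
  qed
  have "integrable unit_leb (\<lambda>t. fiber_conv f n t * echar 0 t)"
    using integral_fold(2)[OF int[of 0]] by (subst (asm) Bochner_Integration.integrable_cong[OF refl fold]) auto
  then show "integrable unit_leb (fiber_conv f n)" by simp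
  have "L2_inner f (WH_system gabor_window (m, n)) = (LINT x|lebesgue. ?u (- m) x)"
    by (simp add: L2_inner_def WH_system_gabor_window mult_ac)
  also have "\<dots> = fourier_coeff (fiber_conv f n) m"
    unfolding integral_fold(3)[OF int] fourier_coeff_def
    by (intro Bochner_Integration.integral_cong refl fold) simp
  finally show "L2_inner f (WH_system gabor_window (m, n)) = fourier_coeff (fiber_conv f n) m" .
qed

lemma measurable_unit_stage:
  assumes "\<And>j. (\<lambda>t. F j t) \<in> borel_measurable unit_leb"
  shows "(\<lambda>t. F (stage_of t) t) \<in> borel_measurable unit_leb"
proof (rule measurable_compose_countable[OF assms])
  show "stage_of \<in> unit_leb \<rightarrow>\<^sub>M count_space UNIV"
    by (intro measurable_restrict_space1 measurable_completion) simp
qed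

lemma corr_fiber_measurable:
  assumes f: "f \<in> L2"
  shows "(\<lambda>t. corr (fiber f t) k) \<in> borel_measurable unit_leb"
proof -
  have int: "integrable lebesgue (\<lambda>x. f x * cnj (translate (of_int k) f x))"
    by (intro L2_mult_integrable translate_L2 f)
  have "(\<Sum>\<^sub>\<infinity>n. f (t - of_int n) * cnj (translate (of_int k) f (t - of_int n))) = corr (fiber f t) k" for t
    unfolding corr_def by (simp add: fiber_def translate_def diff_diff_eq)
  then show ?thesis using integral_fold(2)[OF int] by auto
qed

lemma fiber_energy_measurable:
  assumes f: "f \<in> L2"
  shows "fiber_energy f \<in> borel_measurable unit_leb"
  unfolding fiber_energy_def[abs_def]
proof (rule measurable_unit_stage)
  fix j
  have [measurable]: "(\<lambda>t. cnj (corr (fiber f t) k)) \<in> borel_measurable unit_leb" for k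
    by (rule measurable_compose[OF corr_fiber_measurable[OF f]])
       (auto intro!: borel_measurable_continuous_onI continuous_intros)
  have "(\<lambda>t. window_form j (- stage_radius j) (stage_radius j) (fiber f t)) \<in> borel_measurable unit_leb"
    unfolding window_form_def by measurable
  then show "(\<lambda>t. window_energy j (fiber f t)) \<in> borel_measurable unit_leb"
    unfolding window_energy_def by measurable
qed

lemma
  assumes f: "f \<in> L2"
  shows fiber_energy_integrable: "integrable unit_leb (fiber_energy f)"
    and fiber_energy_lower: "(L2_norm f)\<^sup>2 \<le> (LINT t|unit_leb. fiber_energy f t)"
    and fiber_energy_upper: "(LINT t|unit_leb. fiber_energy f t) \<le> 25 * (L2_norm f)\<^sup>2"
    and fiber_energy_nonneg: "AE t in unit_leb. 0 \<le> fiber_energy f t"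
proof -
  let ?S = "\<lambda>t. \<Sum>\<^sub>\<infinity>n. (cmod (fiber f t n))\<^sup>2"
  have lower: "AE t in unit_leb. ?S t \<le> fiber_energy f t" and upper: "AE t in unit_leb. fiber_energy f t \<le> 25 * ?S t"
    using L2_fiber_square_summable[OF f]
    by (eventually_elim, auto simp: fiber_energy_def intro: window_energy_bounds)+
  have nn: "0 \<le> ?S t" for t by (intro infsum_nonneg) simp
  show nonneg: "AE t in unit_leb. 0 \<le> fiber_energy f t"
    using lower by eventually_elim (use nn order_trans in blast)
  show int: "integrable unit_leb (fiber_energy f)"
  proof (rule Bochner_Integration.integrable_bound)
    show "integrable unit_leb (\<lambda>t. 25 * ?S t)" using L2_fiber_norm_integrable[OF f] by simp
    show "AE t in unit_leb. norm (fiber_energy f t) \<le> norm (25 * ?S t)"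
      using upper nonneg by eventually_elim auto
  qed (rule fiber_energy_measurable[OF f])
  show "(L2_norm f)\<^sup>2 \<le> (LINT t|unit_leb. fiber_energy f t)"
    unfolding L2_norm_fiber[OF f] by (rule integral_mono_AE[OF L2_fiber_norm_integrable[OF f] int lower])
  have "(LINT t|unit_leb. fiber_energy f t) \<le> (LINT t|unit_leb. 25 * ?S t)"
    using L2_fiber_norm_integrable[OF f] by (intro integral_mono_AE[OF int _ upper]) simp
  then show "(LINT t|unit_leb. fiber_energy f t) \<le> 25 * (L2_norm f)\<^sup>2"
    unfolding L2_norm_fiber[OF f] by simp
qed

lemma nonneg_has_sum_imp_nn_integral:
  fixes f :: "'i \<Rightarrow> real"
  assumes "(f has_sum s) UNIV" "\<And>i. 0 \<le> f i"
  shows "(\<integral>\<^sup>+i. ennreal (f i) \<partial>count_space UNIV) = ennreal s"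
proof -
  have "f summable_on UNIV" using assms(1) by (rule has_sum_imp_summable)
  then have abs: "Infinite_Set_Sum.abs_summable_on f UNIV"
    using assms(2) by (simp flip: abs_summable_equivalent)
  show ?thesis
    using nn_integral_conv_infsetsum[OF abs] assms infsetsum_infsum[OF abs] infsumI[OF assms(1)] by simp
qed

lemma nn_integral_imp_nonneg_has_sum:
  fixes f :: "'i \<Rightarrow> real"
  assumes "(\<integral>\<^sup>+i. ennreal (f i) \<partial>count_space UNIV) = ennreal s" "\<And>i. 0 \<le> f i" "0 \<le> s"
  shows "(f has_sum s) UNIV"
proof -
  have "integrable (count_space UNIV) f"
    using assms by (intro integrableI_nonneg) auto
  then have "Infinite_Set_Sum.abs_summable_on f UNIV" by (simp add: abs_summable_on_def)
  then have sum: "f summable_on UNIV"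
    using assms(2) by (simp flip: abs_summable_equivalent)
  then have has: "(f has_sum infsum f UNIV) UNIV" by simp
  have "ennreal (infsum f UNIV) = ennreal s"
    using nonneg_has_sum_imp_nn_integral[OF has assms(2)] assms(1) by simp
  then have "infsum f UNIV = s" using assms by (simp add: infsum_nonneg)
  then show ?thesis using has by simp
qed

lemma fiber_conv_L2_unit:
  assumes f: "f \<in> L2"
  shows "fiber_conv f n \<in> L2_unit"
proof -
  have m: "fiber_conv f n \<in> borel_measurable unit_leb" using fiber_conv_integrable[OF f, of n] by auto
  have le: "AE t in unit_leb. (cmod (fiber_conv f n t))\<^sup>2 \<le> fiber_energy f t"
    using L2_fiber_square_summable[OF f]
  proof eventually_elim
    case (elim t)
    have "(\<Sum>m\<in>{n}. (cmod (fiber_conv f m t))\<^sup>2) \<le> fiber_energy f t"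
      using window_energy_has_sum[OF elim, of "stage_of t"] unfolding fiber_energy_def fiber_conv_def
      by (rule finite_sum_le_has_sum) auto
    then show ?case by simp
  qed
  have "integrable unit_leb (\<lambda>t. (cmod (fiber_conv f n t))\<^sup>2)"
  proof (rule Bochner_Integration.integrable_bound[OF fiber_energy_integrable[OF f]])
    show "(\<lambda>t. (cmod (fiber_conv f n t))\<^sup>2) \<in> borel_measurable unit_leb" using m by measurable
    show "AE t in unit_leb. norm ((cmod (fiber_conv f n t))\<^sup>2) \<le> norm (fiber_energy f t)"
      using le by eventually_elim auto
  qed
  then show ?thesis using m by (simp add: L2_unit_def)
qed

text \<open>
  Parseval in the modulation index for each translation \<open>n\<close>, followed by monotone convergence in \<open>n\<close> and the
  convolution identity on each fiber.
\<close>

theorem WH_coefficients_has_sum: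
  assumes f: "f \<in> L2"
  shows "((\<lambda>p. (cmod (L2_inner f (WH_system gabor_window p)))\<^sup>2) has_sum (LINT t|unit_leb. fiber_energy f t)) UNIV"
proof (rule nn_integral_imp_nonneg_has_sum)
  have [measurable]: "fiber_conv f n \<in> borel_measurable unit_leb" for n
    using fiber_conv_integrable[OF f, of n] by auto
  let ?c = "\<lambda>p. ennreal ((cmod (L2_inner f (WH_system gabor_window p)))\<^sup>2)"
  have "(\<integral>\<^sup>+p. ?c p \<partial>count_space UNIV) = (\<integral>\<^sup>+n. (\<integral>\<^sup>+m. ?c (m, n) \<partial>count_space UNIV) \<partial>count_space UNIV)"
    by (rule nn_integral_snd_count_space[symmetric])
  also have "\<dots> = (\<integral>\<^sup>+n. (\<integral>\<^sup>+t. ennreal ((cmod (fiber_conv f n t))\<^sup>2) \<partial>unit_leb) \<partial>count_space UNIV)"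
  proof (intro nn_integral_cong)
    fix n
    have "(\<integral>\<^sup>+m. ?c (m, n) \<partial>count_space UNIV) = ennreal (LINT t|unit_leb. (cmod (fiber_conv f n t))\<^sup>2)"
      unfolding WH_coefficient[OF f]
      by (rule nonneg_has_sum_imp_nn_integral[OF parseval[OF fiber_conv_L2_unit[OF f]]]) simp
    also have "\<dots> = (\<integral>\<^sup>+t. ennreal ((cmod (fiber_conv f n t))\<^sup>2) \<partial>unit_leb)"
      using fiber_conv_L2_unit[OF f, of n]
      by (intro nn_integral_eq_integral[symmetric]) (auto simp: L2_unit_def)
    finally show "(\<integral>\<^sup>+m. ?c (m, n) \<partial>count_space UNIV) =
        (\<integral>\<^sup>+t. ennreal ((cmod (fiber_conv f n t))\<^sup>2) \<partial>unit_leb)" .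
  qed
  also have "\<dots> = (\<integral>\<^sup>+t. (\<integral>\<^sup>+n. ennreal ((cmod (fiber_conv f n t))\<^sup>2) \<partial>count_space UNIV) \<partial>unit_leb)"
    by (rule nn_integral_count_space_nn_integral[symmetric]) auto
  also have "\<dots> = (\<integral>\<^sup>+t. ennreal (fiber_energy f t) \<partial>unit_leb)"
  proof (rule nn_integral_cong_AE)
    show "AE t in unit_leb. (\<integral>\<^sup>+n. ennreal ((cmod (fiber_conv f n t))\<^sup>2) \<partial>count_space UNIV) = ennreal (fiber_energy f t)"
      using L2_fiber_square_summable[OF f]
    proof eventually_elim
      case (elim t)
      show ?case
        using window_energy_has_sum[OF elim, of "stage_of t"] unfolding fiber_energy_def fiber_conv_def
        by (rule nonneg_has_sum_imp_nn_integral) simp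
    qed
  qed
  also have "\<dots> = ennreal (LINT t|unit_leb. fiber_energy f t)"
    by (rule nn_integral_eq_integral[OF fiber_energy_integrable[OF f] fiber_energy_nonneg[OF f]])
  finally show "(\<integral>\<^sup>+p. ?c p \<partial>count_space UNIV) = ennreal (LINT t|unit_leb. fiber_energy f t)" .
  show "0 \<le> (LINT t|unit_leb. fiber_energy f t)"
    using fiber_energy_lower[OF f] zero_le_power2 order_trans by blast
qed simp

theorem gabor_window_frame: "WH_frame gabor_window"
  unfolding WH_frame_def
proof (rule exI[of _ 1], rule conjI[OF zero_less_one], rule exI[of _ 25],
    rule conjI[OF zero_less_numeral], intro ballI conjI)
  fix f assume f: "f \<in> L2"
  note has = WH_coefficients_has_sum[OF f]
  show "(\<lambda>p. (cmod (L2_inner f (WH_system gabor_window p)))\<^sup>2) summable_on UNIV"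
    using has by (rule has_sum_imp_summable)
  show "1 * (L2_norm f)\<^sup>2 \<le> (\<Sum>\<^sub>\<infinity>p. (cmod (L2_inner f (WH_system gabor_window p)))\<^sup>2)"
    unfolding infsumI[OF has] using fiber_energy_lower[OF f] by simp
  show "(\<Sum>\<^sub>\<infinity>p. (cmod (L2_inner f (WH_system gabor_window p)))\<^sup>2) \<le> 25 * (L2_norm f)\<^sup>2"
    unfolding infsumI[OF has] by (rule fiber_energy_upper[OF f])
qed

lemma identity_partial_sum:
  assumes f: "f \<in> L2"
  shows "integrable unit_leb (\<lambda>t. window_form (stage_of t) \<alpha> \<beta> (fiber f t))"
    and "(\<Sum>k\<in>{\<alpha>..\<beta>}. WH_identity_term gabor_window f k) =
      (LINT t|unit_leb. window_form (stage_of t) \<alpha> \<beta> (fiber f t))"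
  unfolding window_form_def identity_term_eq[OF f]
  by (intro Bochner_Integration.integrable_sum Bochner_Integration.integral_sum[symmetric]
      identity_term_integrable[OF f])+

text \<open>
  Over a fiber of radius at most \<open>n\<close> every partial sum that covers \<open>[-n, n]\<close> is already complete. On the other
  fibers the error is at most \<open>65 + 25\<close> times the squared norm of the fiber, and the integral of this bound over
  those fibers tends to \<open>0\<close> with \<open>n\<close>, by dominated convergence.
\<close>

theorem identity_series_tendsto:
  assumes f: "f \<in> L2"
  shows "((\<lambda>(K::nat, L::nat). \<Sum>k\<in>{- int L..int K}. WH_identity_term gabor_window f k) \<longlongrightarrow>
      complex_of_real (LINT t|unit_leb. fiber_energy f t)) (sequentially \<times>\<^sub>F sequentially)"
proof (rule tendstoI)
  fix e :: real assume e: "0 < e"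
  let ?S = "\<lambda>t. \<Sum>\<^sub>\<infinity>n. (cmod (fiber f t n))\<^sup>2"
  have nn: "0 \<le> ?S t" for t by (intro infsum_nonneg) simp
  \<comment> \<open>a bound for the error of all partial sums that cover \<open>[-n, n]\<close>\<close>
  define W where "W n t = (if int n < stage_radius (stage_of t) then 90 * ?S t else 0)" for n :: nat and t
  have mS: "?S \<in> borel_measurable unit_leb" using L2_fiber_norm_integrable[OF f] by auto
  have W: "W n \<in> borel_measurable unit_leb" for n
    unfolding W_def[abs_def] by (rule measurable_unit_stage) (use mS in simp)
  have S90: "integrable unit_leb (\<lambda>t. 90 * ?S t)" using L2_fiber_norm_integrable[OF f] by simp
  have Wint: "integrable unit_leb (W n)" for n
    by (rule Bochner_Integration.integrable_bound[OF S90 W]) (auto simp: W_def nn intro!: AE_I2)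
  have "(\<lambda>n. LINT t|unit_leb. W n t) \<longlonglongrightarrow> (LINT t|unit_leb. 0)"
  proof (rule integral_dominated_convergence[OF _ W S90])
    show "AE t in unit_leb. (\<lambda>n. W n t) \<longlonglongrightarrow> 0"
    proof (intro AE_I2 tendsto_eventually)
      fix t
      show "\<forall>\<^sub>F n in sequentially. W n t = 0"
        using eventually_ge_at_top[of "nat (stage_radius (stage_of t))"]
        by eventually_elim (auto simp: W_def)
    qed
    show "AE t in unit_leb. norm (W n t) \<le> 90 * ?S t" for n
      using nn by (intro AE_I2) (simp add: W_def)
  qed simp
  then have "\<forall>\<^sub>F n in sequentially. (LINT t|unit_leb. W n t) < e"
    using e by (intro order_tendstoD(2)[where y = 0]) auto
  then obtain n where n: "(LINT t|unit_leb. W n t) < e"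
    by (auto simp: eventually_sequentially)
  have cE: "integrable unit_leb (\<lambda>t. complex_of_real (fiber_energy f t))"
    using fiber_energy_integrable[OF f] by (rule integrable_of_real)
  have "dist (\<Sum>k\<in>{- int L..int K}. WH_identity_term gabor_window f k)
      (complex_of_real (LINT t|unit_leb. fiber_energy f t)) < e" if KL: "n \<le> K" "n \<le> L" for K L :: nat
  proof -
    let ?F = "\<lambda>t. window_form (stage_of t) (- int L) (int K) (fiber f t)"
    note F = identity_partial_sum[OF f, of "- int L" "int K"]
    have "AE t in unit_leb. norm (?F t - complex_of_real (fiber_energy f t)) \<le> W n t"
      using L2_fiber_square_summable[OF f]
    proof eventually_elim
      case (elim t)
      show ?case
      proof (cases "int n < stage_radius (stage_of t)")
        case True
        have "cmod (?F t) \<le> 65 * ?S t" by (rule norm_window_form_le[OF elim])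
        moreover have "cmod (complex_of_real (fiber_energy f t)) \<le> 25 * ?S t"
          unfolding fiber_energy_def
          using window_energy_bounds[OF elim, of "stage_of t"] nn[of t] by simp
        ultimately show ?thesis
          using True norm_triangle_ineq4[of "?F t" "complex_of_real (fiber_energy f t)"] by (simp add: W_def)
      next
        case False
        then have "?F t = window_form (stage_of t) (- stage_radius (stage_of t)) (stage_radius (stage_of t)) (fiber f t)"
          using KL by (intro window_form_wide) auto
        then show ?thesis
          using False by (simp add: window_form_eq_energy[OF elim] fiber_energy_def W_def)
      qed
    qed
    then have "norm (LINT t|unit_leb. ?F t - complex_of_real (fiber_energy f t)) \<le> (LINT t|unit_leb. W n t)"
      using F(1) cE Wint by (intro order_trans[OF integral_norm_bound integral_mono_AE]) auto
    also have "(LINT t|unit_leb. ?F t - complex_of_real (fiber_energy f t)) =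
        (\<Sum>k\<in>{- int L..int K}. WH_identity_term gabor_window f k) -
        complex_of_real (LINT t|unit_leb. fiber_energy f t)"
      unfolding F(2) by (simp add: Bochner_Integration.integral_diff[OF F(1) cE])
    finally show ?thesis using n by (simp add: dist_norm)
  qed
  then show "\<forall>\<^sub>F x in sequentially \<times>\<^sub>F sequentially.
      dist (case x of (K, L) \<Rightarrow> \<Sum>k\<in>{- int L..int K}. WH_identity_term gabor_window f k)
        (complex_of_real (LINT t|unit_leb. fiber_energy f t)) < e"
    unfolding eventually_prod_sequentially by (auto intro!: exI[of _ n])
qed

section \<open>Failure of unconditional convergence\<close>

lemma stage_radius_le_step:
  assumes "i < j"
  shows "stage_radius i \<le> stage_step j"
proof -
  \<comment> \<open>The exponents are compared through \<open>(i + 1)\<^sup>2 = (i + 1 + i) + i\<^sup>2\<close>.\<close>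
  have "(2::int) * 16 ^ i \<le> 32 * 32 ^ i"
    by (intro mult_mono power_mono) auto
  also have "\<dots> = 32 ^ (1 + i)" by simp
  also have "\<dots> \<le> 32 ^ (i + 1 + i)" by (intro power_increasing) auto
  finally have "2 * 16 ^ i * 32 ^ (i * i) \<le> (32::int) ^ (i + 1 + i) * 32 ^ (i * i)"
    by (rule mult_right_mono) simp
  also have "\<dots> = 32 ^ (Suc i * Suc i)" by (simp flip: power_add)
  also have "\<dots> \<le> 32 ^ (j * j)"
    using assms by (intro power_increasing mult_mono) auto
  finally show ?thesis by (simp add: stage_radius_def stage_step_def stage_len_def mult_ac)
qed

lemma stage_step_dvd_window_support:
  assumes "m \<in> window_support i" shows "stage_step i dvd m"
  using assms by (auto simp: window_support_def stage_pos_def)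

text \<open>
  A frequency of stage \<open>j\<close> exceeds all frequencies of the earlier stages, and it is positive and smaller than
  the step of the later stages, which divides all of their frequencies.
\<close>

lemma corr_window_other_stage:
  assumes "i \<noteq> j" "n < stage_len j"
  shows "corr (window i) (stage_pos j n) = 0"
proof (cases "i < j")
  case True
  have "stage_step j * 1 \<le> stage_pos j n"
    unfolding stage_pos_def using stage_step_pos[of j] stage_len_pos[of j] by (intro mult_left_mono) auto
  then show ?thesis using stage_radius_le_step[OF True] by (intro corr_window_eq_0) linarith
next
  case False
  then have "stage_radius j \<le> stage_step i" using assms by (intro stage_radius_le_step) auto
  then have k: "0 < stage_pos j n" "stage_pos j n < stage_step i"
    using stage_pos_bounds[OF assms(2)] by auto
  have "window i b * cnj (window i (b + stage_pos j n)) = 0" if b: "b \<in> window_support i" for b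
  proof -
    have "b + stage_pos j n \<notin> window_support i"
    proof
      assume "b + stage_pos j n \<in> window_support i"
      then have "stage_step i dvd stage_pos j n"
        using stage_step_dvd_window_support[OF b] stage_step_dvd_window_support[of "b + stage_pos j n" i]
        by (simp add: dvd_add_right_iff)
      then show False using k zdvd_not_zless by blast
    qed
    then show ?thesis by (simp add: window_eq_0)
  qed
  then show ?thesis unfolding corr_window by (intro sum.neutral) blast
qed

text \<open>
  Among the pairs of frequencies with this difference, only the one that involves the constant term occurs:
  any other would need a frequency of size at least \<open>stage_radius i\<close>.
\<close>

lemma corr_window_stage_pos:
  assumes "n < stage_len i"
  shows "corr (window i) (stage_pos i n) = of_real (3 * stage_amp i * rs_sign True (4 * i) n)"
proof -
  have zero: "window i b * cnj (window i (b + stage_pos i n)) = 0" if b: "b \<in> window_support i - {0}" for b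
  proof -
    obtain m where "b = stage_pos i m" using b by (auto simp: window_support_def)
    then have "b + stage_pos i n = stage_radius i + stage_step i * (int m + int n)"
      by (simp add: stage_pos_def stage_radius_def algebra_simps)
    then have "b + stage_pos i n \<notin> window_support i"
      using window_support_bounds(2)[of "b + stage_pos i n" i] stage_step_pos[of i]
        mult_nonneg_nonneg[of "stage_step i" "int m + int n"] by fastforce
    then show ?thesis by (simp add: window_eq_0)
  qed
  have "corr (window i) (stage_pos i n) = window i 0 * cnj (window i (0 + stage_pos i n))"
    unfolding corr_window
    by (rule sum.mono_neutral_right[of _ "{0}", THEN trans]) (use zero in \<open>auto simp: window_support_def\<close>)
  then show ?thesis by (simp add: window_0 window_stage_pos[OF assms])
qed

text \<open>
  A box of norm \<open>1\<close>, twice as long as the radius of the stage, so that its autocorrelation is at least \<open>1/2\<close> at all frequencies of the stage.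
\<close>

definition box_fiber :: "nat \<Rightarrow> int \<Rightarrow> complex" where
  "box_fiber i n = (if n \<in> {0..<2 * stage_radius i} then of_real (1 / sqrt (2 * of_int (stage_radius i))) else 0)"

lemma stage_radius_pos: "0 < stage_radius i"
  using stage_step_pos[of i] stage_len_pos[of i] by (simp add: stage_radius_def)

lemma box_fiber_square:
  "1 / sqrt (2 * of_int (stage_radius i)) * (1 / sqrt (2 * of_int (stage_radius i))) = 1 / (2 * of_int (stage_radius i))"
  using stage_radius_pos[of i] by simp

lemma box_function_L2: "fiber_fun box_fiber \<in> L2"
proof (rule fiber_fun_L2)
  fix j
  have "(\<Sum>n\<in>{0..<2 * stage_radius j}. (cmod (box_fiber j n))\<^sup>2) =
      (\<Sum>n\<in>{0..<2 * stage_radius j}. 1 / (2 * of_int (stage_radius j)))"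
    using box_fiber_square[of j] stage_radius_pos[of j]
    by (intro sum.cong) (auto simp: box_fiber_def power2_eq_square norm_divide)
  also have "\<dots> = 1" using stage_radius_pos[of j] by simp
  finally show "(\<Sum>n\<in>{0..<2 * stage_radius j}. (cmod (box_fiber j n))\<^sup>2) \<le> 1" by simp
qed (auto simp: box_fiber_def)

lemma corr_box_fiber:
  assumes "0 \<le> k" "k \<le> stage_radius i"
  obtains r where "corr (box_fiber i) k = of_real r" "1 / 2 \<le> r"
proof
  let ?R = "stage_radius i"
  have "corr (box_fiber i) k = (\<Sum>n\<in>{0..<2 * ?R}. box_fiber i n * cnj (box_fiber i (n + k)))"
    by (rule corr_finite_support) (auto simp: box_fiber_def)
  also have "\<dots> = (\<Sum>n\<in>{0..<2 * ?R}. if n < 2 * ?R - k then of_real (1 / (2 * of_int ?R)) else 0)"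
  proof (intro sum.cong refl)
    fix n assume "n \<in> {0..<2 * ?R}"
    then show "box_fiber i n * cnj (box_fiber i (n + k)) =
        (if n < 2 * ?R - k then of_real (1 / (2 * of_int ?R)) else 0)"
      using assms box_fiber_square[of i]
      by (auto simp: box_fiber_def simp flip: of_real_mult)
  qed
  also have "\<dots> = (\<Sum>n\<in>{0..<2 * ?R - k}. of_real (1 / (2 * of_int ?R)))"
    using assms by (intro sum.mono_neutral_cong_right) auto
  also have "\<dots> = of_real (of_int (2 * ?R - k) / (2 * of_int ?R))"
    using assms by (simp add: of_nat_nat)
  finally show "corr (box_fiber i) k = of_real (of_int (2 * ?R - k) / (2 * of_int ?R))" .
  show "1 / 2 \<le> real_of_int (2 * ?R - k) / (2 * of_int ?R)"
    using assms stage_radius_pos[of i] by (simp add: field_simps)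
qed

definition stage_set :: "nat \<Rightarrow> real set" where
  "stage_set j = {t \<in> {0..<1}. stage_of t = j}"

lemma stage_set_subset: "stage_set j \<subseteq> {0..<1}"
  by (auto simp: stage_set_def)

lemma stage_set_sets: "stage_set j \<in> sets unit_leb"
proof -
  have "stage_of \<in> unit_leb \<rightarrow>\<^sub>M count_space UNIV"
    by (intro measurable_restrict_space1 measurable_completion) simp
  from measurable_sets[OF this, of "{j}"] show ?thesis
    by (simp add: stage_set_def vimage_def Int_def conj_commute)
qed

lemma measure_stage_set_ge:
  assumes "1 \<le> j"
  shows "1 / (real j + 1)\<^sup>2 \<le> measure unit_leb (stage_set j)"
proof -
  interpret finite_measure unit_leb by (rule finite_measure_unit_leb)
  let ?I = "{1 / (real j + 1)<..<1 / real j}"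
  have j: "0 < real j" "1 / real j \<le> 1" using assms by (auto simp: divide_le_eq)
  have sub: "?I \<subseteq> stage_set j"
  proof
    fix t assume t: "t \<in> ?I"
    then have "0 < t" using j by (auto intro: less_trans[of 0 "1 / (real j + 1)"])
    with t j have "real j < 1 / t" "1 / t < real j + 1" by (auto simp: field_simps)
    then have "\<lfloor>1 / t\<rfloor> = int j" by (simp add: floor_eq_iff)
    moreover have "t < 1" using t by (intro less_le_trans[OF _ j(2)]) auto
    ultimately show "t \<in> stage_set j" using \<open>0 < t\<close> by (simp add: stage_set_def stage_of_def)
  qed
  then have I01: "?I \<subseteq> {0..<1}" by (auto simp: stage_set_def)
  have "1 / (real j + 1)\<^sup>2 \<le> 1 / (real j * (real j + 1))"
    using j by (intro frac_le) (auto simp: power2_eq_square)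
  also have "\<dots> = 1 / real j - 1 / (real j + 1)"
    using j by (simp add: field_simps)
  also have "\<dots> = measure unit_leb ?I"
    using j I01 by (simp add: measure_restrict_space field_simps)
  also have "\<dots> \<le> measure unit_leb (stage_set j)"
    using I01 by (intro finite_measure_mono sub stage_set_sets)
  finally show ?thesis .
qed

text \<open>
  Only the fibers over stage \<open>j\<close> contribute at a frequency of stage \<open>j\<close>, and on them the integrand is constant.
\<close>

lemma norm_identity_term_box:
  assumes j: "1 \<le> j" and n: "n < stage_len j"
  shows "3 / 2 * stage_amp j / (real j + 1)\<^sup>2 \<le> cmod (WH_identity_term gabor_window (fiber_fun box_fiber) (stage_pos j n))"
proof -
  let ?k = "stage_pos j n"
  obtain r where r: "corr (box_fiber j) ?k = of_real r" "1 / 2 \<le> r"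
    using corr_box_fiber[of ?k j] stage_pos_bounds[OF n] by (metis less_imp_le)
  let ?v = "3 * stage_amp j * rs_sign True (4 * j) n * r"
  have "WH_identity_term gabor_window (fiber_fun box_fiber) ?k =
      (LINT t|unit_leb. corr (window (stage_of t)) ?k * cnj (corr (fiber (fiber_fun box_fiber) t) ?k))"
    by (rule identity_term_eq[OF box_function_L2])
  also have "\<dots> = (LINT t|unit_leb. indicator (stage_set j) t *\<^sub>R complex_of_real ?v)"
  proof (intro Bochner_Integration.integral_cong refl)
    fix t assume "t \<in> space unit_leb"
    then have t: "t \<in> {0..<1}" by simp
    show "corr (window (stage_of t)) ?k * cnj (corr (fiber (fiber_fun box_fiber) t) ?k) =
        indicator (stage_set j) t *\<^sub>R complex_of_real ?v"
      unfolding fiber_fiber_fun[OF t]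
      using t corr_window_other_stage[OF _ n, of "stage_of t"] corr_window_stage_pos[OF n] r(1)
      by (auto simp: stage_set_def indicator_def)
  qed
  also have "\<dots> = measure unit_leb (stage_set j) *\<^sub>R complex_of_real ?v"
    using stage_set_sets[of j] finite_measure.emeasure_finite[OF finite_measure_unit_leb, of "stage_set j"]
    by (simp add: less_top Int_absorb2[of "stage_set j"] stage_set_subset has_bochner_integral_indicator[THEN has_bochner_integral_integral_eq])
  finally have "cmod (WH_identity_term gabor_window (fiber_fun box_fiber) ?k) =
      measure unit_leb (stage_set j) * \<bar>?v\<bar>"
    by (simp only: norm_scaleR norm_of_real abs_of_nonneg[OF measure_nonneg])
  also have "\<bar>?v\<bar> = 3 * stage_amp j * r"
    using r(2) by (simp add: abs_mult stage_amp_def)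
  also have "1 / (real j + 1)\<^sup>2 * (3 * stage_amp j * (1 / 2)) \<le> measure unit_leb (stage_set j) * (3 * stage_amp j * r)"
    using r(2) by (intro mult_mono measure_stage_set_ge j) (auto simp: stage_amp_def)
  finally show ?thesis by simp
qed

text \<open>
  The \<open>16\<^sup>j\<close> terms at the frequencies of stage \<open>j\<close> contribute at least a multiple of \<open>2\<^sup>j / (j + 1)\<^sup>2\<close> to the sum of
  the absolute values.
\<close>

theorem identity_series_box_not_summable:
  "\<not> (\<lambda>k. WH_identity_term gabor_window (fiber_fun box_fiber) k) summable_on UNIV"
proof
  let ?B = "WH_identity_term gabor_window (fiber_fun box_fiber)"
  assume "?B summable_on UNIV"
  then have sum: "(\<lambda>k. cmod (?B k)) summable_on UNIV"
    by (simp add: summable_on_iff_abs_summable_on_complex)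
  have le: "3 / 2 * 2 ^ j / (real j + 1)\<^sup>2 \<le> (\<Sum>\<^sub>\<infinity>k. cmod (?B k))" if j: "1 \<le> j" for j
  proof -
    have "real (stage_len j) * stage_amp j = 2 ^ j"
      using power_mult_distrib[of "8 :: real" 2 j] by (simp add: stage_len_def stage_amp_def field_simps)
    then have "3 / 2 * 2 ^ j / (real j + 1)\<^sup>2 = (\<Sum>n<stage_len j. 3 / 2 * stage_amp j / (real j + 1)\<^sup>2)"
      by (simp add: field_simps)
    also have "\<dots> \<le> (\<Sum>n<stage_len j. cmod (?B (stage_pos j n)))"
      by (intro sum_mono norm_identity_term_box j) simp
    also have "\<dots> = (\<Sum>k\<in>stage_pos j ` {..<stage_len j}. cmod (?B k))"
      by (simp add: sum.reindex inj_on_def stage_pos_inj)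
    also have "\<dots> \<le> (\<Sum>\<^sub>\<infinity>k. cmod (?B k))"
      by (rule finite_sum_le_infsum[OF sum]) auto
    finally show ?thesis .
  qed
  have "filterlim (\<lambda>j. 3 / 2 * 2 ^ j / (real j + 1)\<^sup>2) at_top sequentially"
    by real_asymp
  then have "\<forall>\<^sub>F j in sequentially. (\<Sum>\<^sub>\<infinity>k. cmod (?B k)) < 3 / 2 * 2 ^ j / (real j + 1)\<^sup>2"
    by (simp add: filterlim_at_top_dense)
  then obtain j0 where "\<And>j. j0 \<le> j \<Longrightarrow> (\<Sum>\<^sub>\<infinity>k. cmod (?B k)) < 3 / 2 * 2 ^ j / (real j + 1)\<^sup>2"
    unfolding eventually_sequentially by blast
  from this[of "Suc j0"] le[of "Suc j0"] show False by simp
qed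

theorem corollary5p10:
  shows "\<exists>g\<in>L2. WH_frame g \<and>
    (\<forall>f\<in>L2.
      ((\<lambda>(K::nat, L::nat). \<Sum>k\<in>{- int L..int K}. WH_identity_term g f k) \<longlongrightarrow>
        complex_of_real (\<Sum>\<^sub>\<infinity>p\<in>UNIV. (cmod (L2_inner f (WH_system g p)))\<^sup>2))
      (sequentially \<times>\<^sub>F sequentially)) \<and>
    (\<exists>h\<in>L2. \<not> (\<lambda>k. WH_identity_term g h k) summable_on UNIV)"
proof (rule bexI[of _ gabor_window], intro conjI ballI)
  show "WH_frame gabor_window" by (rule gabor_window_frame)
  show "\<exists>h\<in>L2. \<not> (\<lambda>k. WH_identity_term gabor_window h k) summable_on UNIV"
    using identity_series_box_not_summable box_function_L2 by blast
  show "gabor_window \<in> L2" by (rule gabor_window_L2)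
next
  fix f assume f: "f \<in> L2"
  show "((\<lambda>(K::nat, L::nat). \<Sum>k\<in>{- int L..int K}. WH_identity_term gabor_window f k) \<longlongrightarrow>
        complex_of_real (\<Sum>\<^sub>\<infinity>p\<in>UNIV. (cmod (L2_inner f (WH_system gabor_window p)))\<^sup>2))
      (sequentially \<times>\<^sub>F sequentially)"
    unfolding infsumI[OF WH_coefficients_has_sum[OF f]] by (rule identity_series_tendsto[OF f])
qed

end
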